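(* Let $f=\sum_{i=1}^m f_i$ with $f_i:\mathbb{R}^d\to\mathbb{R}$. Assume that: (i) each $f_i$ is convex and has $L$-Lipschitz continuous gradient, i.e. $f_i(x)+\langle\nabla f_i(x),y-x\rangle\le f_i(y)\le f_i(x)+\langle\nabla f_i(x),y-x\rangle+\frac L2\|y-x\|^2$ for all $x,y\in\mathbb{R}^d$; (ii) $f_i(x)=\ell(a_i^Tx,b_i)$ with $a_i\in\mathbb{R}^d$, $b_i\in\mathbb{R}$, and $\mathrm{supp}(\nabla f_i(x))=\mathrm{supp}(a_i)$ for every $x$ and $i$. Let $\Delta=\min(\Delta_{\rm ave},\Delta_{\max})$ and $\bar L=L\sqrt{m(1+\Delta)}$. Let $Q$ be an unbiased random quantizer with $\mathbf{E}\|Q(v)-v\|^2\le\beta\|v\|^2$ for all $v$, and let $\tau_k^i\le\tau$ for all $i,k$. Let $\theta>0$, and suppose that $\beta<\frac{1}{2(1+1/\theta)}$ and that the positive step size satisfies $$\gamma<\frac{1}{1+\sqrt{1+8\left(1+\beta(1+\theta)\right)\tau(\tau+1)}}\cdot\frac2{\bar L}.$$ Then the iterates generated by $$x_{k+1}=x_k-\gamma\,Q\Big(\sum_{i=1}^m\nabla f_i(x_{k-\tau_k^i})\Big)$$ satisfy, for every $K\in\mathbb{N}$, $$\min_{k\in[0,K]}\mathbf{E}\|\nabla f(x_k)\|^2\le\frac1a\,\frac1{K+1}\big(f(x_0)-f^\star\big),\qquad a=\frac\gamma2-\gamma\beta(1+1/\theta).$$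
   Context: $\|\cdot\|$ is the Euclidean norm, $\mathrm{supp}(x)=\{i: x^i\ne0\}$, and $[0,K]=\{0,1,\dots,K\}$. $f^\star$ is the minimum value of $f$ (assumed attained). $x_0\in\mathbb{R}^d$ is a deterministic initial point. The delays $\tau_k^i$ are nonnegative integers, $\tau$ is a nonnegative integer, and $x_k:=x_0$ for $k<0$. Conflict graph degrees: $\Delta_{\rm ave}=\frac1m\sum_{i=1}^m\sum_{j\ne i}\mathbf 1\{\mathrm{supp}(a_i)\cap\mathrm{supp}(a_j)\ne\emptyset\}$ and $\Delta_{\max}=\max_{i}\sum_{j\ne i}\mathbf 1\{\mathrm{supp}(a_i)\cap\mathrm{supp}(a_j)\ne\emptyset\}$. An unbiased random quantizer (URQ) with parameter $\alpha$ (finite, positive) is a random mapping $Q:\mathbb{R}^d\to\mathbb{R}^d$ such that for every $v\in\mathbb{R}^d$: $\mathrm{supp}(Q(v))\subseteq\mathrm{supp}(v)$, $\mathbf{E}\{Q(v)\}=v$, and $\mathbf{E}\{\|Q(v)\|^2\}\le\alpha\|v\|^2$. The constant $\beta$ is finite and positive, with $\beta\le\alpha-1$. Each application of $Q$ in the algorithm uses fresh randomness, so these properties hold conditionally on the past iterates. *)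

theory Defs
  imports "HOL-Analysis.Analysis" "HOL-Probability.Probability"
begin

definition grad :: "('a::real_inner \<Rightarrow> real) \<Rightarrow> 'a \<Rightarrow> 'a" where
  "grad f x = (THE D. GDERIV f x :> D)"

definition supp :: "real ^ 'd \<Rightarrow> 'd set" where
  "supp v = {i. v $ i \<noteq> 0}"

lemma GDERIV_grad_eq:
  assumes "GDERIV f x :> D"
  shows "grad f x = D"
proof -
  have "D' = D" if "GDERIV f x :> D'" for D'
  proof -
    have "(\<lambda>h. inner h D') = (\<lambda>h. inner h D)"
      using that assms unfolding gderiv_def by (rule has_derivative_unique)
    then show ?thesis by (metis vector_eq_ldot)
  qed
  with assms show ?thesis
    unfolding grad_def by (rule the_equality[where P = "\<lambda>D. GDERIV f x :> D"])
qed

lemma GDERIV_grad: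
  fixes f :: "'a::euclidean_space \<Rightarrow> real"
  assumes "f differentiable (at x)"
  shows "GDERIV f x :> grad f x"
proof -
  from assms obtain f' where f': "(f has_derivative f') (at x)"
    unfolding differentiable_def by blast
  have "linear f'" using f' by (rule has_derivative_linear)
  define D where "D = (\<Sum>b\<in>Basis. f' b *\<^sub>R b)"
  have "f' h = inner h D" for h
  proof -
    have "f' h = f' (\<Sum>b\<in>Basis. inner h b *\<^sub>R b)" by (simp add: euclidean_representation)
    also have "\<dots> = (\<Sum>b\<in>Basis. inner h b *\<^sub>R f' b)"
      using \<open>linear f'\<close> by (simp add: linear_sum linear_cmul)
    also have "\<dots> = inner h D" by (simp add: D_def inner_sum_right mult.commute)
    finally show ?thesis .
  qed
  then have "f' = (\<lambda>h. inner h D)" by auto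
  with f' have D: "GDERIV f x :> D" by (simp add: gderiv_def)
  then show ?thesis by (simp only: GDERIV_grad_eq[OF D])
qed

(* "Convex with L-Lipschitz gradient", expressed by the two-sided first-order bound. The equivalence
   with Lipschitz continuity of the gradient is convex_smooth_iff_lipschitz below. *)
definition convex_smooth :: "real \<Rightarrow> ('a::euclidean_space \<Rightarrow> real) \<Rightarrow> bool" where
  "convex_smooth L f \<longleftrightarrow>
     (\<forall>x. f differentiable (at x)) \<and> convex_on UNIV f \<and>
     (\<forall>x y. f x + inner (grad f x) (y - x) \<le> f y \<and>
            f y \<le> f x + inner (grad f x) (y - x) + L / 2 * (norm (y - x))\<^sup>2)"

lemma convex_smooth_iff_lipschitz:
  fixes f :: "'a::euclidean_space \<Rightarrow> real"
  assumes L: "0 < L"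
  shows "convex_smooth L f \<longleftrightarrow>
     (\<forall>x. f differentiable (at x)) \<and> convex_on UNIV f \<and> L-lipschitz_on UNIV (grad f)"
proof (cases "(\<forall>x. f differentiable (at x)) \<and> convex_on UNIV f")
  case False
  then show ?thesis unfolding convex_smooth_def by blast
next
  case True
  let ?B = "\<forall>x y. f x + inner (grad f x) (y - x) \<le> f y \<and>
            f y \<le> f x + inner (grad f x) (y - x) + L / 2 * (norm (y - x))\<^sup>2"
  have "?B \<longleftrightarrow> L-lipschitz_on UNIV (grad f)"
  proof
    assume B: ?B
    have coco: "(norm (grad f y - grad f x))\<^sup>2 \<le> 2 * L * (f y - f x - inner (grad f x) (y - x))"
      for x y
    proof -
      define g where "g = grad f y - grad f x"
      define z where "z = y - (1/L) *\<^sub>R g"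
      have "f x + inner (grad f x) (z - x) \<le> f y + inner (grad f y) (z - y) + L / 2 * (norm (z - y))\<^sup>2"
        using B[rule_format, of x z] B[rule_format, of y z] by linarith
      moreover have "inner (grad f x) (z - x) =
          inner (grad f x) (y - x) - inner (grad f x) g / L"
        by (simp add: z_def inner_diff_right algebra_simps)
      moreover have "inner (grad f y) (z - y) = - (inner (grad f y) g / L)"
        by (simp add: z_def)
      moreover have "L / 2 * (norm (z - y))\<^sup>2 = inner g g / (2 * L)"
        using L by (simp add: z_def dot_square_norm power_mult_distrib power2_eq_square field_simps)
      moreover have "inner (grad f y) g / L - inner (grad f x) g / L = 2 * (inner g g / (2 * L))"
      proof -
        have "inner g g = inner (grad f y) g - inner (grad f x) g"
          by (metis g_def inner_diff_left)
        then show ?thesis using L by (simp add: field_simps)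
      qed
      ultimately have "inner g g / (2 * L) \<le> f y - f x - inner (grad f x) (y - x)"
        by linarith
      then show ?thesis using L
        by (simp add: g_def[symmetric] power2_norm_eq_inner field_simps)
    qed
    have "norm (grad f x - grad f y) \<le> L * norm (x - y)" for x y
    proof -
      have "(norm (grad f y - grad f x))\<^sup>2 + (norm (grad f x - grad f y))\<^sup>2
          \<le> 2 * L * inner (grad f x - grad f y) (x - y)"
        using add_mono[OF coco[of y x] coco[of x y]]
        by (simp add: algebra_simps inner_diff_left inner_diff_right)
      then have "(norm (grad f x - grad f y))\<^sup>2 \<le> L * inner (grad f x - grad f y) (x - y)"
        by (simp add: norm_minus_commute)
      also have "\<dots> \<le> L * (norm (grad f x - grad f y) * norm (x - y))"
        using L by (intro mult_left_mono norm_cauchy_schwarz) auto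
      finally have "norm (grad f x - grad f y) * norm (grad f x - grad f y)
          \<le> norm (grad f x - grad f y) * (L * norm (x - y))"
        by (simp add: power2_eq_square algebra_simps)
      then show ?thesis
        using L by (cases "norm (grad f x - grad f y) = 0") (simp, simp only: mult_le_cancel_left, force)
    qed
    then show "L-lipschitz_on UNIV (grad f)"
      using L by (intro lipschitz_onI) (auto simp: dist_norm)
  next
    assume lip: "L-lipschitz_on UNIV (grad f)"
    show ?B
    proof (intro allI)
      fix x y :: 'a
      define h where "h = y - x"
      define p where "p t = f (x + t *\<^sub>R h)" for t
      have dp: "(p has_real_derivative inner (grad f (x + t *\<^sub>R h)) h) (at t)" for t
      proof -
        have "(f has_derivative (\<lambda>v. inner v (grad f (x + t *\<^sub>R h)))) (at (x + t *\<^sub>R h))"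
          using GDERIV_grad True unfolding gderiv_def by blast
        moreover have "((\<lambda>t. x + t *\<^sub>R h) has_derivative (\<lambda>s. s *\<^sub>R h)) (at t)"
          by (auto intro!: derivative_eq_intros)
        ultimately have "(p has_derivative (\<lambda>s. inner (s *\<^sub>R h) (grad f (x + t *\<^sub>R h)))) (at t)"
          unfolding p_def by (rule has_derivative_compose[rotated])
        moreover have "(\<lambda>s. inner (s *\<^sub>R h) (grad f (x + t *\<^sub>R h)))
            = (*) (inner (grad f (x + t *\<^sub>R h)) h)"
          by (rule ext) (simp add: inner_commute[of h])
        ultimately show ?thesis by (simp only: has_field_derivative_def)
      qed
      have cp: "convex_on UNIV p"
      proof (rule convex_onI)
        fix t r s :: real assume t: "0 < t" "t < 1"
        have "x + ((1 - t) *\<^sub>R r + t *\<^sub>R s) *\<^sub>R h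
            = (1 - t) *\<^sub>R (x + r *\<^sub>R h) + t *\<^sub>R (x + s *\<^sub>R h)"
          by (simp add: algebra_simps)
        then show "p ((1 - t) *\<^sub>R r + t *\<^sub>R s) \<le> (1 - t) * p r + t * p s"
          using True t convex_onD[of UNIV f t "x + r *\<^sub>R h" "x + s *\<^sub>R h"] by (simp add: p_def)
      qed auto
      have "p 1 - p 0 \<ge> inner (grad f (x + 0 *\<^sub>R h)) h * (1 - 0)"
        using cp by (rule convex_on_imp_above_tangent)
          (use dp[of 0] in simp_all)
      then have lo: "f x + inner (grad f x) (y - x) \<le> f y"
        by (simp add: p_def h_def)
      define q where "q t = p t - t * inner (grad f x) h - L / 2 * (norm h)\<^sup>2 * t\<^sup>2" for t
      have "q 1 \<le> q 0"
      proof (rule DERIV_nonpos_imp_nonincreasing[where f = q and a = 0 and b = 1])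
        fix t :: real assume t: "0 \<le> t" "t \<le> 1"
        have "(q has_real_derivative
            (inner (grad f (x + t *\<^sub>R h)) h - inner (grad f x) h - L * (norm h)\<^sup>2 * t)) (at t)"
          unfolding q_def by (rule derivative_eq_intros dp refl)+ simp
        moreover have "inner (grad f (x + t *\<^sub>R h)) h - inner (grad f x) h \<le> L * (norm h)\<^sup>2 * t"
        proof -
          have "inner (grad f (x + t *\<^sub>R h) - grad f x) h
              \<le> norm (grad f (x + t *\<^sub>R h) - grad f x) * norm h"
            by (rule norm_cauchy_schwarz)
          also have "\<dots> \<le> (L * norm (t *\<^sub>R h)) * norm h"
            using lipschitz_onD[OF lip, of "x + t *\<^sub>R h" x]
            by (intro mult_right_mono) (auto simp: dist_norm)
          also have "\<dots> = L * (norm h)\<^sup>2 * t" using t by (simp add: power2_eq_square)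
          finally show ?thesis by (simp add: inner_diff_left)
        qed
        ultimately show "\<exists>d. (q has_real_derivative d) (at t) \<and> d \<le> 0"
          by (intro exI conjI) (assumption, linarith)
      qed simp
      moreover have "q 1 = f y - inner (grad f x) (y - x) - L / 2 * (norm (y - x))\<^sup>2"
        by (simp add: q_def p_def h_def)
      moreover have "q 0 = f x"
        by (simp add: q_def p_def)
      ultimately have "f y \<le> f x + inner (grad f x) (y - x) + L / 2 * (norm (y - x))\<^sup>2"
        by linarith
      with lo show "f x + inner (grad f x) (y - x) \<le> f y \<and>
            f y \<le> f x + inner (grad f x) (y - x) + L / 2 * (norm (y - x))\<^sup>2" ..
    qed
  qed
  moreover have "convex_smooth L f \<longleftrightarrow> ?B"
    using True by (simp only: convex_smooth_def simp_thms)
  ultimately show ?thesis using True by (simp only: simp_thms)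
qed

definition conflict_degree :: "nat \<Rightarrow> (nat \<Rightarrow> real ^ 'd) \<Rightarrow> nat \<Rightarrow> nat" where
  "conflict_degree m a i = (\<Sum>j\<in>{1..m} - {i}. of_bool (supp (a i) \<inter> supp (a j) \<noteq> {}))"

definition conflict_ave :: "nat \<Rightarrow> (nat \<Rightarrow> real ^ 'd) \<Rightarrow> real" where
  "conflict_ave m a = 1 / real m * (\<Sum>i = 1..m. real (conflict_degree m a i))"

definition conflict_max :: "nat \<Rightarrow> (nat \<Rightarrow> real ^ 'd) \<Rightarrow> real" where
  "conflict_max m a = real (MAX i\<in>{1..m}. conflict_degree m a i)"

definition conflict_Delta :: "nat \<Rightarrow> (nat \<Rightarrow> real ^ 'd) \<Rightarrow> real" where
  "conflict_Delta m a = min (conflict_ave m a) (conflict_max m a)"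

definition Lbar :: "real \<Rightarrow> nat \<Rightarrow> (nat \<Rightarrow> real ^ 'd) \<Rightarrow> real" where
  "Lbar L m a = L * sqrt (real m * (1 + conflict_Delta m a))"

(* A random mapping is a function of a vector and a random seed with law N. Joint measurability
   makes Q v s a random vector also when v is itself random and independent of s. Integrability
   is explicit because the Bochner integral of a non-integrable function is 0 by convention. *)
definition URQ :: "'s measure \<Rightarrow> (real ^ 'd \<Rightarrow> 's \<Rightarrow> real ^ 'd) \<Rightarrow> real \<Rightarrow> bool" where
  "URQ N Q \<alpha> \<longleftrightarrow>
     prob_space N \<and> 0 < \<alpha> \<and>
     (\<lambda>(v, s). Q v s) \<in> borel_measurable (borel \<Otimes>\<^sub>M N) \<and>
     (\<forall>v. (AE s in N. supp (Q v s) \<subseteq> supp v) \<and>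
          integrable N (Q v) \<and> (LINT s|N. Q v s) = v \<and>
          integrable N (\<lambda>s. (norm (Q v s))\<^sup>2) \<and>
          (LINT s|N. (norm (Q v s))\<^sup>2) \<le> \<alpha> * (norm v)\<^sup>2)"

(* One sample path of the iteration, with seed s k used at step k. Truncated subtraction gives
   x (k - delay k i) = x 0 when delay k i > k, which is the convention x_k = x_0 for k < 0. *)
definition quantized_delayed_gradient_path ::
  "nat \<Rightarrow> (nat \<Rightarrow> real ^ 'd \<Rightarrow> real) \<Rightarrow> (nat \<Rightarrow> nat \<Rightarrow> nat) \<Rightarrow> real \<Rightarrow>
   (real ^ 'd \<Rightarrow> 's \<Rightarrow> real ^ 'd) \<Rightarrow> (nat \<Rightarrow> 's) \<Rightarrow> real ^ 'd \<Rightarrow> (nat \<Rightarrow> real ^ 'd) \<Rightarrow> bool" where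
  "quantized_delayed_gradient_path m f delay \<gamma> Q s x0 x \<longleftrightarrow>
     x 0 = x0 \<and>
     (\<forall>k. x (Suc k) = x k - \<gamma> *\<^sub>R Q (\<Sum>i = 1..m. grad (f i) (x (k - delay k i))) (s k))"

end

theory Submission
  imports Defs
begin

text \<open>Write \<open>\<Lambda>\<close> for the constant \<open>Lbar L m a\<close>, \<open>g\<^sub>k\<close> for the stale gradient
\<open>\<Sum>\<^sub>i \<nabla>f\<^sub>i(x\<^bsub>k - \<tau>\<^sub>k\<^sup>i\<^esub>)\<close> and \<open>h = \<gamma> \<Lambda>\<close>.

Sparsity makes \<open>F\<close> smooth with constant \<open>\<Lambda>\<close> instead of \<open>m L\<close>: two component gradients
with disjoint supports are orthogonal, so the squared norm of a sum of \<open>m\<close> of them has at most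
\<open>m (1 + \<Delta>)\<close> nonzero inner products (\<open>norm_sum_le_conflict\<close>). The same count bounds the error
of staleness, \<open>\<parallel>\<nabla>F(x\<^sub>k) - g\<^sub>k\<parallel> \<le> \<Lambda> r\<close> when every delayed iterate is within \<open>r\<close> of \<open>x\<^sub>k\<close>
(\<open>sum_grad_diff_le\<close>), and \<open>r\<close> is at most the path length of the last \<open>\<tau>\<close> steps.

Let \<open>P, G, E, D\<close> be the expectations of the squared norms of \<open>\<nabla>F(x\<^sub>k)\<close>, \<open>g\<^sub>k\<close>,
\<open>\<nabla>F(x\<^sub>k) - g\<^sub>k\<close> and \<open>Q(g\<^sub>k)\<close>. The seed of step \<open>k\<close> is independent of the past, so
\<open>Q(g\<^sub>k)\<close> may be replaced by \<open>g\<^sub>k\<close> inside an inner product with \<open>\<nabla>F(x\<^sub>k)\<close>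
(\<open>fresh_quantization\<close>), and the descent inequality of the smooth function \<open>F\<close> becomes
\<open>\<Phi>\<^bsub>k+1\<^esub> \<le> \<Phi>\<^sub>k - \<gamma>/2 (P\<^sub>k + G\<^sub>k - E\<^sub>k) + \<gamma>h/2 D\<^sub>k\<close> for \<open>\<Phi>\<^sub>k = \<bbbE> F(x\<^sub>k)\<close>.
The variance bound gives \<open>D \<le> G + \<beta> G\<close>. Only the summand \<open>\<beta> G\<close> is traded for
\<open>P\<close> and \<open>E\<close>, through \<open>G \<le> (1 + 1/\<theta>) P + (1 + \<theta>) E\<close>; the remaining \<open>G\<close> is kept to
absorb \<open>D\<close>. With \<open>B = \<beta>(1 + 1/\<theta>)\<close> and \<open>c = 1 + \<beta>(1 + \<theta>)\<close> each step then
decreases \<open>\<Phi>\<close> by at least \<open>\<gamma>/2 ((1 - B) P + (1 - h) D - c E)\<close>. Summed over \<open>k\<close>, the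
staleness errors cost at most \<open>c h\<^sup>2 \<tau>\<^sup>2 \<Sum>D\<close>, because every step occurs in at most \<open>\<tau>\<close>
windows. The step size restriction yields \<open>h + c h\<^sup>2 \<tau>\<^sup>2 \<le> 1\<close>, so all multiples of \<open>D\<close> drop out
and \<open>\<gamma>/2 (1 - B) \<Sum>P \<le> F(x\<^sub>0) - F\<^sup>\<star>\<close> remains (\<open>delayed_descent_sum\<close>).
The constant of the theorem is \<open>\<gamma>/2 (1 - 2B)\<close>, which is smaller, and positive since
\<open>B < 1/2\<close>; the smallest \<open>P\<^sub>k\<close> is at most the mean.\<close>

section \<open>Conflict graph and smoothness of the sum\<close>

lemma conflict_ave_le_max:
  assumes "1 \<le> m"
  shows "conflict_ave m a \<le> conflict_max m a"
proof -
  let ?D = "MAX i\<in>{1..m}. conflict_degree m a i"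
  have "(\<Sum>i = 1..m. real (conflict_degree m a i)) \<le> (\<Sum>i = 1..m. real ?D)"
    by (intro sum_mono) (auto intro!: Max_ge)
  with assms show ?thesis
    by (simp add: conflict_ave_def conflict_max_def field_simps)
qed

text \<open>An average never exceeds the maximum. So it suffices to bound norms in terms of the average degree,
which amounts to counting ordered conflicting pairs.\<close>

lemma conflict_Delta_eq_ave: "1 \<le> m \<Longrightarrow> conflict_Delta m a = conflict_ave m a"
  by (simp add: conflict_Delta_def conflict_ave_le_max min_absorb1)

lemma conflict_ave_nonneg: "0 \<le> conflict_ave m a"
  by (simp add: conflict_ave_def sum_nonneg)

lemma inner_eq_0_if_disjoint_supp:
  fixes u v :: "real ^ 'd"
  assumes "supp u \<inter> supp v = {}"
  shows "inner u v = 0"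
  unfolding inner_vec_def
proof (intro sum.neutral ballI)
  fix i
  have "u $ i = 0 \<or> v $ i = 0"
    using assms by (auto simp: supp_def)
  then show "inner (u $ i) (v $ i) = 0"
    by auto
qed

text \<open>Expand the square into inner products. A pair \<open>i \<noteq> j\<close> contributes at most \<open>r\<^sup>2\<close>, and
nothing at all if the two supports are disjoint, so the \<open>m\<close> diagonal terms and the
\<open>m \<Delta>\<close> ordered conflicting pairs are the only ones to be paid for.\<close>

lemma norm_sum_le_conflict:
  fixes u :: "nat \<Rightarrow> real ^ 'd"
  assumes m: "1 \<le> m" and r: "0 \<le> r"
    and supp: "\<And>i. i \<in> {1..m} \<Longrightarrow> supp (u i) \<subseteq> supp (a i)"
    and bound: "\<And>i. i \<in> {1..m} \<Longrightarrow> norm (u i) \<le> r"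
  shows "norm (\<Sum>i = 1..m. u i) \<le> sqrt (real m * (1 + conflict_Delta m a)) * r"
proof -
  let ?c = "\<lambda>i j. of_bool (supp (a i) \<inter> supp (a j) \<noteq> {}) :: real"
  have inner_le: "inner (u i) (u j) \<le> ?c i j * r\<^sup>2" if ij: "i \<in> {1..m}" "j \<in> {1..m}" for i j
  proof (cases "supp (a i) \<inter> supp (a j) = {}")
    case True
    then have "inner (u i) (u j) = 0"
      using supp[OF ij(1)] supp[OF ij(2)] by (intro inner_eq_0_if_disjoint_supp) blast
    then show ?thesis by simp
  next
    case False
    have "inner (u i) (u j) \<le> norm (u i) * norm (u j)"
      by (rule norm_cauchy_schwarz)
    also have "\<dots> \<le> r * r"
      using bound ij r by (intro mult_mono) auto
    finally show ?thesis using False by (simp add: power2_eq_square)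
  qed
  have diag_le: "inner (u i) (u i) \<le> r\<^sup>2" if "i \<in> {1..m}" for i
    using power_mono[OF bound[OF that], of 2] by (simp add: power2_norm_eq_inner)
  have "(norm (\<Sum>i = 1..m. u i))\<^sup>2 = (\<Sum>i = 1..m. \<Sum>j = 1..m. inner (u i) (u j))"
    by (subst sum.swap) (simp add: power2_norm_eq_inner inner_sum_left inner_sum_right)
  also have "\<dots> = (\<Sum>i = 1..m. inner (u i) (u i) + (\<Sum>j\<in>{1..m} - {i}. inner (u i) (u j)))"
    by (intro sum.cong refl sum.remove) auto
  also have "\<dots> \<le> (\<Sum>i = 1..m. r\<^sup>2 + (\<Sum>j\<in>{1..m} - {i}. ?c i j * r\<^sup>2))"
    by (intro sum_mono add_mono diag_le inner_le) auto
  also have "\<dots> = real m * r\<^sup>2 + (\<Sum>i = 1..m. real (conflict_degree m a i)) * r\<^sup>2"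
    by (simp add: sum.distrib sum_distrib_right conflict_degree_def)
  also have "(\<Sum>i = 1..m. real (conflict_degree m a i)) = real m * conflict_Delta m a"
    using m by (simp add: conflict_Delta_eq_ave conflict_ave_def)
  also have "real m * r\<^sup>2 + real m * conflict_Delta m a * r\<^sup>2
      = real m * (1 + conflict_Delta m a) * r\<^sup>2"
    by (simp add: algebra_simps)
  also have "\<dots> = (sqrt (real m * (1 + conflict_Delta m a)) * r)\<^sup>2"
    using m conflict_ave_nonneg[of m a] by (simp add: power_mult_distrib conflict_Delta_eq_ave)
  finally show ?thesis
    by (rule power2_le_imp_le) (use r m conflict_ave_nonneg[of m a] in \<open>simp add: conflict_Delta_eq_ave\<close>)
qed

lemma Lbar_pos:
  assumes "1 \<le> m" "0 < L"
  shows "0 < Lbar L m a"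
proof -
  have "0 < real m * (1 + conflict_Delta m a)"
    using assms conflict_ave_nonneg[of m a]
    by (intro mult_pos_pos add_pos_nonneg) (auto simp: conflict_Delta_eq_ave)
  then show ?thesis using assms unfolding Lbar_def by simp
qed

lemma supp_diff_subset: "supp (u - v) \<subseteq> supp u \<union> supp v"
  by (auto simp: supp_def)

text \<open>With all \<open>y i\<close> equal this is the Lipschitz bound for the gradient of the sum. Distinct
points \<open>y i\<close> cover the stale gradient, whose components are read at different times; the constant
is the same in both cases because \<open>norm_sum_le_conflict\<close> needs only a common bound on the
norms of the summands.\<close>

lemma sum_grad_diff_le:
  fixes f :: "nat \<Rightarrow> real ^ 'd \<Rightarrow> real" and y :: "nat \<Rightarrow> real ^ 'd"
  assumes m: "1 \<le> m" and L: "0 < L"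
    and smooth: "\<And>i. i \<in> {1..m} \<Longrightarrow> convex_smooth L (f i)"
    and supp_grad: "\<And>i z. i \<in> {1..m} \<Longrightarrow> supp (grad (f i) z) = supp (a i)"
    and near: "\<And>i. i \<in> {1..m} \<Longrightarrow> norm (z - y i) \<le> r"
  shows "norm ((\<Sum>i = 1..m. grad (f i) z) - (\<Sum>i = 1..m. grad (f i) (y i))) \<le> Lbar L m a * r"
proof -
  have r: "0 \<le> r"
    using near[of 1] m order_trans[OF norm_ge_zero] by auto
  have "norm (\<Sum>i = 1..m. grad (f i) z - grad (f i) (y i))
      \<le> sqrt (real m * (1 + conflict_Delta m a)) * (L * r)"
  proof (rule norm_sum_le_conflict[OF m])
    fix i assume i: "i \<in> {1..m}"
    show "supp (grad (f i) z - grad (f i) (y i)) \<subseteq> supp (a i)"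
      using supp_diff_subset[of "grad (f i) z" "grad (f i) (y i)"] supp_grad[OF i] by simp
    have lip: "L-lipschitz_on UNIV (grad (f i))"
      using smooth[OF i] convex_smooth_iff_lipschitz[OF L] by blast
    have "norm (grad (f i) z - grad (f i) (y i)) \<le> L * norm (z - y i)"
      using lipschitz_onD[OF lip, of z "y i"] by (simp add: dist_norm)
    also have "\<dots> \<le> L * r" using near[OF i] L by simp
    finally show "norm (grad (f i) z - grad (f i) (y i)) \<le> L * r" .
  qed (use L r in simp)
  then show ?thesis
    by (simp add: Lbar_def sum_subtractf mult.assoc mult.left_commute)
qed

lemma GDERIV_sum_grad:
  fixes f :: "'i \<Rightarrow> 'a::euclidean_space \<Rightarrow> real"
  assumes "\<And>i. i \<in> I \<Longrightarrow> f i differentiable (at z)"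
  shows "GDERIV (\<lambda>z. \<Sum>i\<in>I. f i z) z :> (\<Sum>i\<in>I. grad (f i) z)"
proof -
  have "((\<lambda>z. \<Sum>i\<in>I. f i z) has_derivative (\<lambda>h. \<Sum>i\<in>I. inner h (grad (f i) z))) (at z)"
    using GDERIV_grad[OF assms] by (intro has_derivative_sum) (simp add: gderiv_def)
  then show ?thesis by (simp add: gderiv_def inner_sum_right)
qed

lemma sum_convex_smooth:
  fixes f :: "nat \<Rightarrow> real ^ 'd \<Rightarrow> real"
  assumes m: "1 \<le> m" and L: "0 < L"
    and smooth: "\<And>i. i \<in> {1..m} \<Longrightarrow> convex_smooth L (f i)"
    and supp_grad: "\<And>i z. i \<in> {1..m} \<Longrightarrow> supp (grad (f i) z) = supp (a i)"
  shows "grad (\<lambda>z. \<Sum>i = 1..m. f i z) z = (\<Sum>i = 1..m. grad (f i) z)"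
    and "convex_smooth (Lbar L m a) (\<lambda>z. \<Sum>i = 1..m. f i z)"
proof -
  let ?F = "\<lambda>z. \<Sum>i = 1..m. f i z"
  have diff: "f i differentiable (at z)" if "i \<in> {1..m}" for i z
    using smooth[OF that] by (simp add: convex_smooth_def)
  have gd: "GDERIV ?F z :> (\<Sum>i = 1..m. grad (f i) z)" for z
    by (rule GDERIV_sum_grad[OF diff])
  show grad: "grad ?F z = (\<Sum>i = 1..m. grad (f i) z)" for z
    by (rule GDERIV_grad_eq[OF gd])
  have "?F differentiable (at z)" for z
    using gd[of z] unfolding gderiv_def differentiable_def by blast
  moreover have "convex_on UNIV (\<lambda>z. \<Sum>i\<in>I. f i z)" if "finite I" "I \<subseteq> {1..m}" for I
    using that smooth
    by (induction I rule: finite_induct) (auto simp: convex_smooth_def convex_on_const intro!: convex_on_add)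
  then have "convex_on UNIV ?F" by simp
  moreover have "(Lbar L m a)-lipschitz_on UNIV (grad ?F)"
  proof (rule lipschitz_onI)
    show "dist (grad ?F z) (grad ?F y) \<le> Lbar L m a * dist z y" for z y
      unfolding grad dist_norm
      by (rule sum_grad_diff_le[OF m L smooth supp_grad order_refl])
  qed (use Lbar_pos[OF m L, of a] in simp)
  ultimately show "convex_smooth (Lbar L m a) ?F"
    using convex_smooth_iff_lipschitz[OF Lbar_pos[OF m L]] by blast
qed

section \<open>Delays and the summed descent inequality\<close>

text \<open>A gap of \<open>d\<close> steps is bounded by the path length over a window that no longer depends on
\<open>d\<close>, so that one bound serves all components. Truncated subtraction cuts the window off at
time 0, in agreement with \<open>x\<^sub>k = x\<^sub>0\<close> for negative \<open>k\<close>.\<close>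

lemma delayed_iterate_gap:
  fixes x :: "nat \<Rightarrow> 'a::real_normed_vector"
  assumes "d \<le> \<tau>"
  shows "norm (x k - x (k - d)) \<le> (\<Sum>j\<in>{k - \<tau>..<k}. norm (x (Suc j) - x j))"
proof -
  have "x k - x (k - d) = (\<Sum>j\<in>{k - d..<k}. x (Suc j) - x j)"
    by (simp add: sum_Suc_diff')
  also have "norm \<dots> \<le> (\<Sum>j\<in>{k - d..<k}. norm (x (Suc j) - x j))"
    by (rule norm_sum)
  also have "\<dots> \<le> (\<Sum>j\<in>{k - \<tau>..<k}. norm (x (Suc j) - x j))"
    using assms by (intro sum_mono2) auto
  finally show ?thesis .
qed

lemma power2_window_sum_le:
  fixes u :: "nat \<Rightarrow> real"
  shows "(\<Sum>j\<in>{k - \<tau>..<k}. u j)\<^sup>2 \<le> real \<tau> * (\<Sum>j\<in>{k - \<tau>..<k}. (u j)\<^sup>2)"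
proof -
  have "(\<Sum>j\<in>{k - \<tau>..<k}. u j)\<^sup>2 \<le> (\<Sum>j\<in>{k - \<tau>..<k}. (u j)\<^sup>2) * real (card {k - \<tau>..<k})"
    using sum_squared_le_sum_of_squares[of u "{k - \<tau>..<k}"] by simp
  also have "\<dots> \<le> (\<Sum>j\<in>{k - \<tau>..<k}. (u j)\<^sup>2) * real \<tau>"
    by (intro mult_left_mono sum_nonneg) auto
  finally show ?thesis by (simp add: mult.commute)
qed

text \<open>Exchange the two sums: index \<open>j\<close> lies in the window of \<open>k\<close> only if
\<open>j < k \<le> j + \<tau>\<close>, which leaves at most \<open>\<tau>\<close> values of \<open>k\<close>.\<close>

lemma sum_window_sums_le:
  fixes D :: "nat \<Rightarrow> real"
  assumes D: "\<And>j. 0 \<le> D j"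
  shows "(\<Sum>k\<le>K. \<Sum>j\<in>{k - \<tau>..<k}. D j) \<le> real \<tau> * (\<Sum>k\<le>K. D k)"
proof -
  \<comment> \<open>windows of indices up to \<open>K\<close> stay below \<open>K\<close>, so both sums range over \<open>{..K}\<close>\<close>
  have "(\<Sum>k\<le>K. \<Sum>j\<in>{k - \<tau>..<k}. D j) = (\<Sum>k\<le>K. \<Sum>j | j \<in> {..K} \<and> j \<in> {k - \<tau>..<k}. D j)"
    by (intro sum.cong refl) auto
  also have "\<dots> = (\<Sum>j\<le>K. \<Sum>k | k \<in> {..K} \<and> j \<in> {k - \<tau>..<k}. D j)"
    by (rule sum.swap_restrict) auto
  also have "\<dots> \<le> (\<Sum>j\<le>K. real \<tau> * D j)"
  proof (rule sum_mono)
    fix j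
    have "card {k. k \<in> {..K} \<and> j \<in> {k - \<tau>..<k}} \<le> card {j<..j + \<tau>}"
      by (intro card_mono) auto
    then show "(\<Sum>k | k \<in> {..K} \<and> j \<in> {k - \<tau>..<k}. D j) \<le> real \<tau> * D j"
      using D[of j] by (auto intro!: mult_right_mono)
  qed
  finally show ?thesis by (simp add: sum_distrib_left)
qed

text \<open>The deterministic core of the convergence proof, in which \<open>\<Phi>\<close> is the expected objective.
Eliminating \<open>G\<close> by \<open>second_moment\<close> turns its negative coefficient into one for \<open>D\<close>, and
\<open>D\<close> is exactly what the staleness errors are measured in. A single step need not decrease
\<open>\<Phi>\<close>, because \<open>E k\<close> involves earlier steps; only the sum over all steps balances.\<close>

lemma delayed_descent_sum:
  fixes \<Phi> P G D E :: "nat \<Rightarrow> real"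
  assumes step: "\<And>k. \<Phi> (Suc k) \<le> \<Phi> k - \<gamma> / 2 * (P k + G k - E k) + \<gamma> * h / 2 * D k"
    and second_moment: "\<And>k. D k \<le> G k + B * P k + (c - 1) * E k"
    and staleness: "\<And>k. E k \<le> h\<^sup>2 * (real \<tau> * (\<Sum>j\<in>{k - \<tau>..<k}. D j))"
    and D: "\<And>k. 0 \<le> D k"
    and \<gamma>: "0 < \<gamma>" and c: "0 \<le> c" and h: "h + c * h\<^sup>2 * (real \<tau>)\<^sup>2 \<le> 1"
  shows "\<gamma> / 2 * (1 - B) * (\<Sum>k\<le>K. P k) \<le> \<Phi> 0 - \<Phi> (Suc K)"
proof -
  have "2 / \<gamma> * \<Phi> (Suc k) \<le> 2 / \<gamma> * \<Phi> k - (1 - B) * P k - (1 - h) * D k + c * E k" for k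
  proof -
    have "2 / \<gamma> * \<Phi> (Suc k)
        \<le> 2 / \<gamma> * (\<Phi> k - \<gamma> / 2 * (P k + G k - E k) + \<gamma> * h / 2 * D k)"
      using step[of k] \<gamma> by (intro mult_left_mono) auto
    also have "\<dots> = 2 / \<gamma> * \<Phi> k - (P k + G k - E k) + h * D k"
      using \<gamma> by (simp add: field_simps)
    also have "\<dots> \<le> 2 / \<gamma> * \<Phi> k - (1 - B) * P k - (1 - h) * D k + c * E k"
      using second_moment[of k] by (simp add: algebra_simps)
    finally show ?thesis .
  qed
  then have "(\<Sum>k\<le>K. (1 - B) * P k) \<le> (\<Sum>k\<le>K. 2 / \<gamma> * \<Phi> k - 2 / \<gamma> * \<Phi> (Suc k)
      - (1 - h) * D k + c * E k)"
    by (intro sum_mono) (smt (verit))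
  also have "\<dots> = 2 / \<gamma> * \<Phi> 0 - 2 / \<gamma> * \<Phi> (Suc K) - (1 - h) * (\<Sum>k\<le>K. D k) + c * (\<Sum>k\<le>K. E k)"
    using sum_telescope[of "\<lambda>k. 2 / \<gamma> * \<Phi> k" K]
    by (simp add: sum.distrib sum_subtractf sum_distrib_left)
  also have "c * (\<Sum>k\<le>K. E k) \<le> c * h\<^sup>2 * (real \<tau>)\<^sup>2 * (\<Sum>k\<le>K. D k)"
  proof -
    have "(\<Sum>k\<le>K. E k) \<le> h\<^sup>2 * (real \<tau> * (\<Sum>k\<le>K. \<Sum>j\<in>{k - \<tau>..<k}. D j))"
      using sum_mono[of "{..K}", OF staleness] by (simp add: sum_distrib_left)
    also have "\<dots> \<le> h\<^sup>2 * (real \<tau> * (real \<tau> * (\<Sum>k\<le>K. D k)))"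
      by (intro mult_left_mono sum_window_sums_le D) auto
    finally have "(\<Sum>k\<le>K. E k) \<le> h\<^sup>2 * (real \<tau>)\<^sup>2 * (\<Sum>k\<le>K. D k)"
      by (simp add: power2_eq_square mult.assoc)
    from mult_left_mono[OF this c] show ?thesis by (simp add: mult.assoc)
  qed
  also have "2 / \<gamma> * \<Phi> 0 - 2 / \<gamma> * \<Phi> (Suc K) - (1 - h) * (\<Sum>k\<le>K. D k)
        + c * h\<^sup>2 * (real \<tau>)\<^sup>2 * (\<Sum>k\<le>K. D k)
      = 2 / \<gamma> * (\<Phi> 0 - \<Phi> (Suc K)) - (1 - (h + c * h\<^sup>2 * (real \<tau>)\<^sup>2)) * (\<Sum>k\<le>K. D k)"
    by (simp add: algebra_simps)
  also have "\<dots> \<le> 2 / \<gamma> * (\<Phi> 0 - \<Phi> (Suc K))"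
    using h D by (simp add: sum_nonneg)
  finally have "(1 - B) * (\<Sum>k\<le>K. P k) \<le> 2 / \<gamma> * (\<Phi> 0 - \<Phi> (Suc K))"
    by (simp add: sum_distrib_left)
  then have "\<gamma> / 2 * ((1 - B) * (\<Sum>k\<le>K. P k)) \<le> \<gamma> / 2 * (2 / \<gamma> * (\<Phi> 0 - \<Phi> (Suc K)))"
    using \<gamma> by (intro mult_left_mono) auto
  then show ?thesis
    using \<gamma> by (simp add: mult.assoc)
qed

text \<open>The bound on \<open>h\<close> is the positive root of \<open>A h\<^sup>2 + h - 1\<close>, written without \<open>A\<close> in the
denominator so that \<open>A = 0\<close> (no delay) is covered.\<close>

lemma step_size_margin:
  fixes A h :: real
  assumes A: "0 \<le> A" and h: "0 < h" "h < 2 / (1 + sqrt (1 + 4 * A))"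
  shows "h + A * h\<^sup>2 \<le> 1"
proof -
  define s where "s = sqrt (1 + 4 * A)"
  have s: "0 \<le> s" "s\<^sup>2 = 1 + 4 * A"
    using A by (simp_all add: s_def)
  have "h * (1 + s) < 2"
    using h(2) s(1) unfolding s_def[symmetric] by (simp add: field_simps)
  then have "h * s \<le> 2 - h" by (simp add: algebra_simps)
  then have "(h * s)\<^sup>2 \<le> (2 - h)\<^sup>2"
    using h(1) s(1) by (intro power_mono) auto
  then have "h\<^sup>2 * (1 + 4 * A) \<le> 4 - 4 * h + h\<^sup>2"
    by (simp add: power_mult_distrib s(2) power2_diff)
  then show ?thesis by (simp add: algebra_simps)
qed

section \<open>Square-integrable random vectors\<close>

text \<open>Every second moment below must be known to be finite before its integral means anything.
This class of random vectors is closed under all operations of the iteration.\<close>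

definition sq_integrable :: "'w measure \<Rightarrow> ('w \<Rightarrow> 'a::euclidean_space) \<Rightarrow> bool" where
  "sq_integrable M X \<longleftrightarrow> X \<in> borel_measurable M \<and> integrable M (\<lambda>\<omega>. (norm (X \<omega>))\<^sup>2)"

lemma sq_integrableI_bound:
  assumes "X \<in> borel_measurable M" "integrable M H" "\<And>\<omega>. \<omega> \<in> space M \<Longrightarrow> (norm (X \<omega>))\<^sup>2 \<le> H \<omega>"
  shows "sq_integrable M X"
  unfolding sq_integrable_def
proof (intro conjI)
  show "integrable M (\<lambda>\<omega>. (norm (X \<omega>))\<^sup>2)"
    using assms by (intro Bochner_Integration.integrable_bound[OF assms(2)] AE_I2)
      (auto intro: order_trans[OF _ abs_ge_self])
qed (rule assms)

lemma sq_integrable_cong: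
  assumes "\<And>\<omega>. \<omega> \<in> space M \<Longrightarrow> X \<omega> = Y \<omega>"
  shows "sq_integrable M X \<longleftrightarrow> sq_integrable M Y"
  unfolding sq_integrable_def
  using assms by (intro conj_cong measurable_cong Bochner_Integration.integrable_cong) auto

text \<open>Young's inequality for the triangle inequality: the right-hand side exceeds
\<open>(\<parallel>u\<parallel> + \<parallel>u - v\<parallel>)\<^sup>2\<close> by the square of \<open>\<parallel>u\<parallel> - \<theta> \<parallel>u - v\<parallel>\<close> divided by \<open>\<theta>\<close>.\<close>

lemma power2_norm_le_weighted:
  fixes u v :: "'a::real_normed_vector"
  assumes \<theta>: "0 < \<theta>"
  shows "(norm v)\<^sup>2 \<le> (1 + 1 / \<theta>) * (norm u)\<^sup>2 + (1 + \<theta>) * (norm (u - v))\<^sup>2"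
proof -
  define w where "w = u - v"
  have v: "norm v \<le> norm u + norm w"
    using norm_triangle_ineq4[of u w] by (simp add: w_def)
  have "(norm v)\<^sup>2 \<le> (norm u + norm w)\<^sup>2"
    using v by (intro power_mono) auto
  also have "\<dots> \<le> (norm u + norm w)\<^sup>2 + (norm u - \<theta> * norm w)\<^sup>2 / \<theta>"
    using \<theta> by simp
  also have "\<dots> = (1 + 1 / \<theta>) * (norm u)\<^sup>2 + (1 + \<theta>) * (norm w)\<^sup>2"
    using \<theta> by (simp add: field_simps power2_eq_square)
  finally show ?thesis by (simp add: w_def)
qed

lemma power2_norm_add_le: "(norm (u + v))\<^sup>2 \<le> 2 * (norm u)\<^sup>2 + 2 * (norm v)\<^sup>2"
  for u v :: "'a::real_normed_vector"
  using power2_norm_le_weighted[of 1 "u + v" u] by simp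

lemma sq_integrable_add:
  assumes "sq_integrable M X" "sq_integrable M Y"
  shows "sq_integrable M (\<lambda>\<omega>. X \<omega> + Y \<omega>)"
  using assms unfolding sq_integrable_def
  by (intro sq_integrableI_bound[unfolded sq_integrable_def,
        where H = "\<lambda>\<omega>. 2 * (norm (X \<omega>))\<^sup>2 + 2 * (norm (Y \<omega>))\<^sup>2"])
     (auto intro: power2_norm_add_le)

lemma sq_integrable_scaleR:
  assumes "sq_integrable M X"
  shows "sq_integrable M (\<lambda>\<omega>. c *\<^sub>R X \<omega>)"
  using assms unfolding sq_integrable_def by (auto simp: power_mult_distrib)

lemma sq_integrable_diff:
  assumes "sq_integrable M X" "sq_integrable M Y"
  shows "sq_integrable M (\<lambda>\<omega>. X \<omega> - Y \<omega>)"
  using sq_integrable_add[OF assms(1) sq_integrable_scaleR[OF assms(2), of "-1"]] by simp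

lemma sq_integrable_sum:
  assumes "\<And>i. i \<in> I \<Longrightarrow> sq_integrable M (X i)"
  shows "sq_integrable M (\<lambda>\<omega>. \<Sum>i\<in>I. X i \<omega>)"
proof (cases "finite I")
  case True
  then show ?thesis using assms
  proof (induction I rule: finite_induct)
    case empty
    show ?case by (simp add: sq_integrable_def)
  qed (simp add: sq_integrable_add)
qed (simp add: sq_integrable_def)

lemma (in finite_measure) sq_integrable_lipschitz:
  fixes g :: "'b::euclidean_space \<Rightarrow> 'c::euclidean_space"
  assumes g: "C-lipschitz_on UNIV g" and X: "sq_integrable M X"
  shows "sq_integrable M (\<lambda>\<omega>. g (X \<omega>))"
proof (rule sq_integrableI_bound)
  have "g \<in> borel_measurable borel"
    by (intro borel_measurable_continuous_onI lipschitz_on_continuous_on[OF g])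
  then show "(\<lambda>\<omega>. g (X \<omega>)) \<in> borel_measurable M"
    using X by (auto simp: sq_integrable_def)
  show "integrable M (\<lambda>\<omega>. 2 * (norm (g 0))\<^sup>2 + 2 * (C\<^sup>2 * (norm (X \<omega>))\<^sup>2))"
    using X by (auto simp: sq_integrable_def)
  show "(norm (g (X \<omega>)))\<^sup>2 \<le> 2 * (norm (g 0))\<^sup>2 + 2 * (C\<^sup>2 * (norm (X \<omega>))\<^sup>2)" for \<omega>
  proof -
    have "norm (g (X \<omega>) - g 0) \<le> C * norm (X \<omega>)"
      using lipschitz_onD[OF g, of "X \<omega>" 0] by (simp add: dist_norm)
    then have "(norm (g (X \<omega>) - g 0))\<^sup>2 \<le> C\<^sup>2 * (norm (X \<omega>))\<^sup>2"
      using power_mono[of _ _ 2] by (fastforce simp: power_mult_distrib)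
    then show ?thesis
      using power2_norm_add_le[of "g 0" "g (X \<omega>) - g 0"] by simp
  qed
qed

lemma sq_integrable_integrable_inner:
  assumes "sq_integrable M X" "sq_integrable M Y"
  shows "integrable M (\<lambda>\<omega>. inner (X \<omega>) (Y \<omega>))"
proof (rule Bochner_Integration.integrable_bound)
  show "integrable M (\<lambda>\<omega>. (norm (X \<omega>))\<^sup>2 + (norm (Y \<omega>))\<^sup>2)"
    using assms by (auto simp: sq_integrable_def)
  show "(\<lambda>\<omega>. inner (X \<omega>) (Y \<omega>)) \<in> borel_measurable M"
    using assms by (auto simp: sq_integrable_def)
  have "\<bar>inner (X \<omega>) (Y \<omega>)\<bar> \<le> (norm (X \<omega>))\<^sup>2 + (norm (Y \<omega>))\<^sup>2" for \<omega>
  proof -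
    have "\<bar>inner (X \<omega>) (Y \<omega>)\<bar> \<le> norm (X \<omega>) * norm (Y \<omega>)"
      by (rule Cauchy_Schwarz_ineq2)
    moreover have "0 \<le> norm (X \<omega>) * norm (Y \<omega>)" by simp
    ultimately show ?thesis
      using sum_squares_bound[of "norm (X \<omega>)" "norm (Y \<omega>)"] by linarith
  qed
  then show "AE \<omega> in M. norm (inner (X \<omega>) (Y \<omega>)) \<le> norm ((norm (X \<omega>))\<^sup>2 + (norm (Y \<omega>))\<^sup>2)"
    by simp
qed

text \<open>The remainder of the affine approximation at 0 lies between 0 and a multiple of the
squared norm.\<close>

lemma (in finite_measure) integrable_convex_smooth:
  assumes F: "convex_smooth \<Lambda> F" and X: "sq_integrable M X"
  shows "integrable M (\<lambda>\<omega>. F (X \<omega>))"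
proof -
  define r where "r z = F z - F 0 - inner (grad F 0) z" for z
  have "F differentiable_on UNIV"
    using F by (simp add: convex_smooth_def differentiable_on_def)
  then have [measurable]: "F \<in> borel_measurable borel"
    by (intro borel_measurable_continuous_onI differentiable_imp_continuous_on)
  have [measurable]: "X \<in> borel_measurable M"
    using X by (simp add: sq_integrable_def)
  have "integrable M (\<lambda>\<omega>. \<Lambda> / 2 * (norm (X \<omega>))\<^sup>2)"
    using X by (simp add: sq_integrable_def)
  then have r: "integrable M (\<lambda>\<omega>. r (X \<omega>))"
  proof (rule Bochner_Integration.integrable_bound)
    show "(\<lambda>\<omega>. r (X \<omega>)) \<in> borel_measurable M"
      unfolding r_def by measurable
    have "0 \<le> r z" "r z \<le> \<Lambda> / 2 * (norm z)\<^sup>2" for z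
      using F[unfolded convex_smooth_def, THEN conjunct2, THEN conjunct2, rule_format, of 0 z]
      by (auto simp: r_def)
    then show "AE \<omega> in M. norm (r (X \<omega>)) \<le> norm (\<Lambda> / 2 * (norm (X \<omega>))\<^sup>2)"
      by (intro AE_I2) (smt (verit) real_norm_def)
  qed
  have "sq_integrable M (\<lambda>_. grad F 0)"
    by (simp add: sq_integrable_def)
  then have "integrable M (\<lambda>\<omega>. F 0 + inner (grad F 0) (X \<omega>) + r (X \<omega>))"
    using r sq_integrable_integrable_inner[OF _ X] by simp
  then show ?thesis
    by (simp add: r_def)
qed

section \<open>Fresh seeds and the past\<close>

text \<open>Independence is stated for a sub-\<open>\<sigma>\<close>-algebra \<open>S\<close> and a random element \<open>\<eta>\<close>, as an
\<open>indep_set\<close> of events: \<open>indep_var\<close> would force the identity on the sample space and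
\<open>\<eta>\<close> to have values in the same type. The identity into \<open>S\<close> plays the role of the past, and both
measures agree on rectangles by independence.\<close>

lemma (in prob_space) joint_distr_fresh_seed:
  assumes S: "space S = space M"
    and \<eta>: "\<eta> \<in> measurable M N" and law: "distr M N \<eta> = N"
    and indep: "indep_set (sets S) {\<eta> -` A \<inter> space M | A. A \<in> sets N}"
  shows "distr M S (\<lambda>\<omega>. \<omega>) \<Otimes>\<^sub>M N = distr M (S \<Otimes>\<^sub>M N) (\<lambda>\<omega>. (\<omega>, \<eta> \<omega>))"
proof -
  have sub: "sets S \<subseteq> events"
    using indep by (simp add: indep_sets2_eq)
  have id: "(\<lambda>\<omega>. \<omega>) \<in> measurable M S"
    using sub sets.sets_into_space[of _ S]
    by (auto simp: measurable_def S Int_absorb2)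
  have N: "emeasure N B = emeasure M (\<eta> -` B \<inter> space M)" if "B \<in> sets N" for B
    using emeasure_distr[OF \<eta> that] by (simp add: law)
  interpret R: prob_space "distr M S (\<lambda>\<omega>. \<omega>)" by (rule prob_space_distr) (rule id)
  interpret N: prob_space N using prob_space_distr[OF \<eta>] by (simp add: law)
  show ?thesis
  proof (rule pair_measure_eqI)
    fix A B assume "A \<in> sets (distr M S (\<lambda>\<omega>. \<omega>))" and B: "B \<in> sets N"
    then have A: "A \<in> sets S" by simp
    then have AM: "A \<in> events" "A \<subseteq> space M"
      using sub sets.sets_into_space[of A S] S by auto
    have \<eta>B: "\<eta> -` B \<inter> space M \<in> events"
      using \<eta> B by (rule measurable_sets)
    have pair: "(\<lambda>\<omega>. (\<omega>, \<eta> \<omega>)) \<in> measurable M (S \<Otimes>\<^sub>M N)"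
      using id \<eta> by (rule measurable_Pair)
    have "(\<lambda>\<omega>. (\<omega>, \<eta> \<omega>)) -` (A \<times> B) \<inter> space M = A \<inter> (\<eta> -` B \<inter> space M)"
      by auto
    then have "emeasure (distr M (S \<Otimes>\<^sub>M N) (\<lambda>\<omega>. (\<omega>, \<eta> \<omega>))) (A \<times> B)
        = emeasure M (A \<inter> (\<eta> -` B \<inter> space M))"
      using A B by (simp add: emeasure_distr[OF pair])
    also have "\<dots> = ennreal (prob A * prob (\<eta> -` B \<inter> space M))"
      using indep_setD[OF indep A, of "\<eta> -` B \<inter> space M"] B
      by (auto simp: emeasure_eq_measure)
    also have "\<dots> = emeasure M A * emeasure M (\<eta> -` B \<inter> space M)"
      by (simp add: emeasure_eq_measure ennreal_mult)
    also have "\<dots> = emeasure (distr M S (\<lambda>\<omega>. \<omega>)) A * emeasure N B"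
      using AM B N by (simp add: emeasure_distr[OF id A] Int_absorb2)
    finally show "emeasure (distr M S (\<lambda>\<omega>. \<omega>)) A * emeasure N B
        = emeasure (distr M (S \<Otimes>\<^sub>M N) (\<lambda>\<omega>. (\<omega>, \<eta> \<omega>))) (A \<times> B)" ..
  qed (simp_all add: R.sigma_finite_measure_axioms N.sigma_finite_measure_axioms
      cong: sets_pair_measure_cong)
qed

text \<open>Conditioning on the past, expressed without conditional expectations: the seed may be
integrated out first while the outcome \<open>\<omega>\<close>, as seen by \<open>S\<close>, is held fixed. This is Fubini for
the joint distribution of the past and the seed.\<close>

lemma (in prob_space) integral_fresh_seed:
  fixes \<psi> :: "'a \<Rightarrow> 's \<Rightarrow> real"
  assumes S: "space S = space M"
    and \<eta> [measurable]: "\<eta> \<in> measurable M N" and law: "distr M N \<eta> = N"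
    and indep: "indep_set (sets S) {\<eta> -` A \<inter> space M | A. A \<in> sets N}"
    and meas: "(\<lambda>(\<omega>, s). \<psi> \<omega> s) \<in> borel_measurable (S \<Otimes>\<^sub>M N)"
    and int: "\<And>\<omega>. \<omega> \<in> space M \<Longrightarrow> integrable N (\<psi> \<omega>)"
    and bound: "\<And>\<omega>. \<omega> \<in> space M \<Longrightarrow> (LINT s|N. \<bar>\<psi> \<omega> s\<bar>) \<le> H \<omega>"
    and H: "integrable M H"
  shows "integrable M (\<lambda>\<omega>. \<psi> \<omega> (\<eta> \<omega>))"
    and "(LINT \<omega>|M. \<psi> \<omega> (\<eta> \<omega>)) = (LINT \<omega>|M. LINT s|N. \<psi> \<omega> s)"
proof -
  have id [measurable]: "(\<lambda>\<omega>. \<omega>) \<in> measurable M S"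
    using indep sets.sets_into_space[of _ S]
    by (auto simp: indep_sets2_eq measurable_def S Int_absorb2)
  let ?R = "distr M S (\<lambda>\<omega>. \<omega>)"
  interpret R: prob_space ?R by (rule prob_space_distr) (rule id)
  interpret N: prob_space N using prob_space_distr[OF \<eta>] by (simp add: law)
  interpret RN: pair_sigma_finite ?R N ..
  have joint: "?R \<Otimes>\<^sub>M N = distr M (S \<Otimes>\<^sub>M N) (\<lambda>\<omega>. (\<omega>, \<eta> \<omega>))"
    by (rule joint_distr_fresh_seed[OF S \<eta> law indep])
  have [measurable]: "(\<lambda>(\<omega>, s). \<psi> \<omega> s) \<in> borel_measurable (?R \<Otimes>\<^sub>M N)"
    using meas by (simp cong: measurable_cong_sets)
  have [measurable]: "(\<lambda>\<omega>. LINT s|N. \<bar>\<psi> \<omega> s\<bar>) \<in> borel_measurable S"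
      "(\<lambda>\<omega>. LINT s|N. \<psi> \<omega> s) \<in> borel_measurable S"
    using meas by (measurable)
  have "integrable M (\<lambda>\<omega>. LINT s|N. \<bar>\<psi> \<omega> s\<bar>)"
  proof (rule Bochner_Integration.integrable_bound[OF H])
    show "AE \<omega> in M. norm (LINT s|N. \<bar>\<psi> \<omega> s\<bar>) \<le> norm (H \<omega>)"
      using bound by (intro AE_I2) (auto intro: order_trans[OF _ abs_ge_self])
  qed measurable
  then have "integrable ?R (\<lambda>\<omega>. LINT s|N. \<bar>\<psi> \<omega> s\<bar>)"
    by (simp add: integrable_distr_eq)
  then have RN: "integrable (?R \<Otimes>\<^sub>M N) (\<lambda>(\<omega>, s). \<psi> \<omega> s)"
    using int S by (intro RN.Fubini_integrable) (auto intro!: AE_I2)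
  then show "integrable M (\<lambda>\<omega>. \<psi> \<omega> (\<eta> \<omega>))"
    using meas by (simp add: joint integrable_distr_eq)
  have "(LINT \<omega>|M. \<psi> \<omega> (\<eta> \<omega>)) = (LINT p|(?R \<Otimes>\<^sub>M N). (\<lambda>(\<omega>, s). \<psi> \<omega> s) p)"
    using meas by (simp add: joint integral_distr)
  also have "\<dots> = (LINT \<omega>|?R. LINT s|N. \<psi> \<omega> s)"
    using RN.integral_fst'[OF RN] by simp
  also have "\<dots> = (LINT \<omega>|M. LINT s|N. \<psi> \<omega> s)"
    by (simp add: integral_distr)
  finally show "(LINT \<omega>|M. \<psi> \<omega> (\<eta> \<omega>)) = (LINT \<omega>|M. LINT s|N. \<psi> \<omega> s)" .
qed

text \<open>Generated by the seeds before step \<open>k\<close> jointly, as one random element of a product space: in this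
form the independence of disjoint blocks of an independent family applies to it.\<close>

definition past_seeds ::
  "'w measure \<Rightarrow> 's measure \<Rightarrow> (nat \<Rightarrow> 'w \<Rightarrow> 's) \<Rightarrow> nat \<Rightarrow> 'w measure" where
  "past_seeds M N \<xi> k =
     vimage_algebra (space M) (\<lambda>\<omega>. restrict (\<lambda>i. \<xi> i \<omega>) {..<k}) (PiM {..<k} (\<lambda>_. N))"

lemma space_past_seeds [simp]: "space (past_seeds M N \<xi> k) = space M"
  by (simp add: past_seeds_def)

text \<open>Disjoint blocks of an independent family are independent, here the blocks \<open>{..<k}\<close> and
\<open>{k}\<close>. The second block, a family with one member, generates at least the events of
\<open>\<xi> k\<close>.\<close>

lemma (in prob_space) past_seeds_indep:
  assumes indep: "indep_vars (\<lambda>_. N) \<xi> UNIV"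
  shows "indep_set (sets (past_seeds M N \<xi> k)) {\<xi> k -` A \<inter> space M | A. A \<in> sets N}"
proof -
  let ?R = "\<lambda>\<omega>. restrict (\<lambda>i. \<xi> i \<omega>) {..<k}" and ?R' = "\<lambda>\<omega>. restrict (\<lambda>i. \<xi> i \<omega>) {k}"
  let ?T = "{?R' -` A \<inter> space M | A. A \<in> sets (PiM {k} (\<lambda>_. N))}"
  have "indep_var (PiM {..<k} (\<lambda>_. N)) ?R (PiM {k} (\<lambda>_. N)) ?R'"
    by (rule indep_var_restrict[OF indep]) auto
  then have set: "indep_set (sets (past_seeds M N \<xi> k)) (sigma_sets (space M) ?T)"
    by (simp add: indep_var_eq past_seeds_def sets_vimage_algebra)
  have R': "?R' \<in> measurable M (PiM {k} (\<lambda>_. N))"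
    using indep by (auto simp: indep_vars_def intro!: measurable_restrict)
  have "\<xi> k -` A \<inter> space M \<in> ?T" if A: "A \<in> sets N" for A
  proof -
    let ?A = "(\<lambda>r. r k) -` A \<inter> space (PiM {k} (\<lambda>_. N))"
    have "?A \<in> sets (PiM {k} (\<lambda>_. N))"
      using A by (intro measurable_sets[OF measurable_component_singleton]) auto
    moreover have "\<xi> k -` A \<inter> space M = ?R' -` ?A \<inter> space M"
      using measurable_space[OF R'] by auto
    ultimately show ?thesis by blast
  qed
  then have sub: "{\<xi> k -` A \<inter> space M | A. A \<in> sets N} \<subseteq> sigma_sets (space M) ?T"
    by (auto intro: sigma_sets.Basic simp del: mem_Collect_eq)
  show ?thesis
  proof (rule indep_setI)
    show "sets (past_seeds M N \<xi> k) \<subseteq> events"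
      using set by (simp add: indep_sets2_eq)
    show "{\<xi> k -` A \<inter> space M | A. A \<in> sets N} \<subseteq> events"
      by (rule order_trans[OF sub]) (use set in \<open>simp add: indep_sets2_eq\<close>)
    show "prob (A \<inter> B) = prob A * prob B"
      if "A \<in> sets (past_seeds M N \<xi> k)" "B \<in> {\<xi> k -` A \<inter> space M | A. A \<in> sets N}" for A B
      using indep_setD[OF set that(1) subsetD[OF sub that(2)]] .
  qed
qed

lemma measurable_past_seeds_mono:
  assumes \<xi>: "\<And>i. \<xi> i \<in> measurable M N" and jk: "j \<le> k"
    and g: "g \<in> measurable (past_seeds M N \<xi> j) T"
  shows "g \<in> measurable (past_seeds M N \<xi> k) T"
proof -
  let ?R = "\<lambda>k \<omega>. restrict (\<lambda>i. \<xi> i \<omega>) {..<k}"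
  have Rk: "?R k \<in> measurable (past_seeds M N \<xi> k) (PiM {..<k} (\<lambda>_. N))"
    unfolding past_seeds_def
    using measurable_space[OF \<xi>] by (intro measurable_vimage_algebra1) (auto simp: space_PiM)
  have "(\<lambda>\<omega>. restrict (?R k \<omega>) {..<j}) \<in> measurable (past_seeds M N \<xi> k) (PiM {..<j} (\<lambda>_. N))"
    using jk by (intro measurable_compose[OF Rk measurable_restrict_subset]) auto
  moreover have "(\<lambda>\<omega>. restrict (?R k \<omega>) {..<j}) = ?R j"
    using jk by (auto simp: restrict_def fun_eq_iff)
  ultimately have Rj: "?R j \<in> measurable (past_seeds M N \<xi> k) (PiM {..<j} (\<lambda>_. N))"
    by (simp only:)
  have "(\<lambda>\<omega>. \<omega>) \<in> measurable (past_seeds M N \<xi> k) (past_seeds M N \<xi> j)"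
    unfolding past_seeds_def[of M N \<xi> j] by (rule measurable_vimage_algebra2[OF _ Rj]) simp
  from measurable_compose[OF this g] show ?thesis .
qed

lemma measurable_past_seeds_seed:
  assumes \<xi>: "\<And>i. \<xi> i \<in> measurable M N"
  shows "\<xi> k \<in> measurable (past_seeds M N \<xi> (Suc k)) N"
proof -
  have "(\<lambda>\<omega>. restrict (\<lambda>i. \<xi> i \<omega>) {..<Suc k})
      \<in> measurable (past_seeds M N \<xi> (Suc k)) (PiM {..<Suc k} (\<lambda>_. N))"
    unfolding past_seeds_def
    using measurable_space[OF \<xi>] by (intro measurable_vimage_algebra1) (auto simp: space_PiM)
  from measurable_compose[OF this measurable_component_singleton[of k]] show ?thesis
    by simp
qed

text \<open>Bias-variance decomposition around the mean \<open>v\<close>.\<close>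

lemma URQ_second_moment:
  fixes Q :: "real ^ 'd \<Rightarrow> 's \<Rightarrow> real ^ 'd"
  assumes Q: "URQ N Q \<alpha>"
    and err: "(LINT s|N. (norm (Q v s - v))\<^sup>2) \<le> \<beta> * (norm v)\<^sup>2"
  shows "(LINT s|N. (norm (Q v s))\<^sup>2) \<le> (1 + \<beta>) * (norm v)\<^sup>2"
proof -
  interpret N: prob_space N using Q by (simp add: URQ_def)
  have int: "integrable N (Q v)" "integrable N (\<lambda>s. (norm (Q v s))\<^sup>2)" and
    mean: "(LINT s|N. Q v s) = v"
    using Q by (auto simp: URQ_def)
  have "(LINT s|N. (norm (Q v s - v))\<^sup>2)
      = (LINT s|N. (norm (Q v s))\<^sup>2 - 2 * inner (Q v s) v + (norm v)\<^sup>2)"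
    by (intro Bochner_Integration.integral_cong refl)
      (simp add: power2_norm_eq_inner inner_diff_left inner_diff_right inner_commute)
  also have "\<dots> = (LINT s|N. (norm (Q v s))\<^sup>2) - 2 * inner v v + (norm v)\<^sup>2"
    using int mean by (simp add: N.prob_space)
  finally show ?thesis
    using err by (simp add: power2_norm_eq_inner algebra_simps)
qed

text \<open>A vector determined by the past and quantized with a fresh seed: the bounds for fixed
arguments carry over to random ones. The third claim is unbiasedness in the only form that the
descent argument uses, tested against a vector \<open>W\<close> that is also determined by the past.\<close>

lemma (in prob_space) fresh_quantization:
  fixes Q :: "real ^ 'd \<Rightarrow> 's \<Rightarrow> real ^ 'd"
  assumes S: "space S = space M"
    and \<eta> [measurable]: "\<eta> \<in> measurable M N" and law: "distr M N \<eta> = N"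
    and indep: "indep_set (sets S) {\<eta> -` A \<inter> space M | A. A \<in> sets N}"
    and Q: "URQ N Q \<alpha>"
    and err: "\<And>v. (LINT s|N. (norm (Q v s - v))\<^sup>2) \<le> \<beta> * (norm v)\<^sup>2"
    and V_meas: "V \<in> borel_measurable S" and V: "sq_integrable M V"
  shows "sq_integrable M (\<lambda>\<omega>. Q (V \<omega>) (\<eta> \<omega>))"
    and "(LINT \<omega>|M. (norm (Q (V \<omega>) (\<eta> \<omega>)))\<^sup>2) \<le> (1 + \<beta>) * (LINT \<omega>|M. (norm (V \<omega>))\<^sup>2)"
    and "W \<in> borel_measurable S \<Longrightarrow> sq_integrable M W \<Longrightarrow>
      (LINT \<omega>|M. inner (W \<omega>) (Q (V \<omega>) (\<eta> \<omega>))) = (LINT \<omega>|M. inner (W \<omega>) (V \<omega>))"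
proof -
  have id [measurable]: "(\<lambda>\<omega>. \<omega>) \<in> measurable M S"
    using indep sets.sets_into_space[of _ S]
    by (auto simp: indep_sets2_eq measurable_def S Int_absorb2)
  interpret N: prob_space N using Q by (simp add: URQ_def)
  note [measurable] = V_meas
  have Q_meas: "(\<lambda>(v, s). Q v s) \<in> borel_measurable (borel \<Otimes>\<^sub>M N)"
    and Q_int: "integrable N (Q v)" "integrable N (\<lambda>s. (norm (Q v s))\<^sup>2)"
    and Q_mean: "(LINT s|N. Q v s) = v" for v
    using Q by (auto simp: URQ_def)
  have QV [measurable]: "(\<lambda>p. Q (V (fst p)) (snd p)) \<in> borel_measurable (S \<Otimes>\<^sub>M N)"
    using measurable_compose[of "\<lambda>p. (V (fst p), snd p)" "S \<Otimes>\<^sub>M N" "borel \<Otimes>\<^sub>M N", OF _ Q_meas]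
    by simp
  have "(\<lambda>\<omega>. (\<omega>, \<eta> \<omega>)) \<in> measurable M (S \<Otimes>\<^sub>M N)" by measurable
  from measurable_compose[OF this QV]
  have QV_meas: "(\<lambda>\<omega>. Q (V \<omega>) (\<eta> \<omega>)) \<in> borel_measurable M" by simp
  have moment: "(LINT s|N. (norm (Q v s))\<^sup>2) \<le> (1 + \<beta>) * (norm v)\<^sup>2" for v
    using URQ_second_moment[OF Q err] .
  have H: "integrable M (\<lambda>\<omega>. (1 + \<beta>) * (norm (V \<omega>))\<^sup>2)"
    using V by (simp add: sq_integrable_def)
  have sq: "integrable M (\<lambda>\<omega>. (norm (Q (V \<omega>) (\<eta> \<omega>)))\<^sup>2)"
    "(LINT \<omega>|M. (norm (Q (V \<omega>) (\<eta> \<omega>)))\<^sup>2) = (LINT \<omega>|M. LINT s|N. (norm (Q (V \<omega>) s))\<^sup>2)"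
    by (rule integral_fresh_seed[OF S \<eta> law indep _ _ _ H,
          where \<psi> = "\<lambda>\<omega> s. (norm (Q (V \<omega>) s))\<^sup>2"];
        (simp add: Q_int moment case_prod_beta)?)+
  show "sq_integrable M (\<lambda>\<omega>. Q (V \<omega>) (\<eta> \<omega>))"
    using QV_meas sq(1) by (simp add: sq_integrable_def)
  have mono: "(LINT \<omega>|M. LINT s|N. (norm (Q (V \<omega>) s))\<^sup>2) \<le> (LINT \<omega>|M. (1 + \<beta>) * (norm (V \<omega>))\<^sup>2)"
    by (rule integral_mono'[OF H moment]) (rule order_trans[OF _ moment], simp)
  show "(LINT \<omega>|M. (norm (Q (V \<omega>) (\<eta> \<omega>)))\<^sup>2) \<le> (1 + \<beta>) * (LINT \<omega>|M. (norm (V \<omega>))\<^sup>2)"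
    using mono by (simp add: sq(2))
  assume W_meas [measurable]: "W \<in> borel_measurable S" and W: "sq_integrable M W"
  have H': "integrable M (\<lambda>\<omega>. (norm (W \<omega>))\<^sup>2 + (1 + \<beta>) * (norm (V \<omega>))\<^sup>2)"
    using W H by (simp add: sq_integrable_def)
  have bound: "(LINT s|N. \<bar>inner w (Q v s)\<bar>) \<le> (norm w)\<^sup>2 + (1 + \<beta>) * (norm v)\<^sup>2" for w v
  proof -
    have "\<bar>inner w (Q v s)\<bar> \<le> (norm w)\<^sup>2 + (norm (Q v s))\<^sup>2" for s
    proof -
      have "\<bar>inner w (Q v s)\<bar> \<le> norm w * norm (Q v s)" by (rule Cauchy_Schwarz_ineq2)
      moreover have "0 \<le> norm w * norm (Q v s)" by simp
      ultimately show ?thesis using sum_squares_bound[of "norm w" "norm (Q v s)"] by linarith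
    qed
    then have "(LINT s|N. \<bar>inner w (Q v s)\<bar>) \<le> (LINT s|N. (norm w)\<^sup>2 + (norm (Q v s))\<^sup>2)"
      using Q_int by (intro integral_mono) auto
    also have "\<dots> = (norm w)\<^sup>2 + (LINT s|N. (norm (Q v s))\<^sup>2)"
      using Q_int by (simp add: N.prob_space)
    also have "\<dots> \<le> (norm w)\<^sup>2 + (1 + \<beta>) * (norm v)\<^sup>2"
      using moment by simp
    finally show ?thesis .
  qed
  have "(LINT \<omega>|M. inner (W \<omega>) (Q (V \<omega>) (\<eta> \<omega>))) = (LINT \<omega>|M. LINT s|N. inner (W \<omega>) (Q (V \<omega>) s))"
    by (rule integral_fresh_seed(2)[OF S \<eta> law indep _ _ _ H',
          where \<psi> = "\<lambda>\<omega> s. inner (W \<omega>) (Q (V \<omega>) s)"])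
       (simp_all add: Q_int bound case_prod_beta)
  then show "(LINT \<omega>|M. inner (W \<omega>) (Q (V \<omega>) (\<eta> \<omega>))) = (LINT \<omega>|M. inner (W \<omega>) (V \<omega>))"
    by (simp add: Q_int Q_mean)
qed

text \<open>The iterate \<open>x k\<close> and the direction \<open>g k\<close> to be quantized depend on the seeds before step
\<open>k\<close> only, by induction over all earlier iterates; square integrability survives each step because
\<open>u i\<close> grows at most linearly and quantization with a fresh seed multiplies the second moment by at
most \<open>1 + \<beta>\<close>.\<close>

lemma (in prob_space) delayed_iterates_adapted:
  fixes Q :: "real ^ 'd \<Rightarrow> 's \<Rightarrow> real ^ 'd" and u :: "nat \<Rightarrow> real ^ 'd \<Rightarrow> real ^ 'd"
    and x g :: "nat \<Rightarrow> 'a \<Rightarrow> real ^ 'd"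
  assumes g_eq: "\<And>k \<omega>. g k \<omega> = (\<Sum>i\<in>I. u i (x (k - delay k i) \<omega>))"
    and lip: "\<And>i. i \<in> I \<Longrightarrow> C-lipschitz_on UNIV (u i)"
    and indep: "indep_vars (\<lambda>_. N) \<xi> UNIV" and law: "\<And>k. distr M N (\<xi> k) = N"
    and Q: "URQ N Q \<alpha>"
    and err: "\<And>v. (LINT s|N. (norm (Q v s - v))\<^sup>2) \<le> \<beta> * (norm v)\<^sup>2"
    and init: "\<And>\<omega>. \<omega> \<in> space M \<Longrightarrow> x 0 \<omega> = z0"
    and step: "\<And>k \<omega>. \<omega> \<in> space M \<Longrightarrow> x (Suc k) \<omega> = x k \<omega> - \<gamma> *\<^sub>R Q (g k \<omega>) (\<xi> k \<omega>)"
  shows "x k \<in> borel_measurable (past_seeds M N \<xi> k)" "sq_integrable M (x k)"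
    and "g k \<in> borel_measurable (past_seeds M N \<xi> k)" "sq_integrable M (g k)"
proof -
  let ?S = "past_seeds M N \<xi>"
  have g_def: "g = (\<lambda>k \<omega>. \<Sum>i\<in>I. u i (x (k - delay k i) \<omega>))"
    by (intro ext g_eq)
  have \<xi>: "\<xi> k \<in> measurable M N" for k
    using indep by (simp add: indep_vars_def)
  have u: "u i \<in> borel_measurable borel" if "i \<in> I" for i
    using lipschitz_on_continuous_on[OF lip[OF that]] by (rule borel_measurable_continuous_onI)
  have g: "g k \<in> borel_measurable (?S k) \<and> sq_integrable M (g k)"
    if x: "\<And>j. j \<le> k \<Longrightarrow> x j \<in> borel_measurable (?S j) \<and> sq_integrable M (x j)" for k
  proof
    have "x (k - delay k i) \<in> borel_measurable (?S k)" for i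
      by (rule measurable_past_seeds_mono[OF \<xi>, of "k - delay k i"]) (use x in auto)
    then show "g k \<in> borel_measurable (?S k)"
      unfolding g_def by (intro borel_measurable_sum) (rule measurable_compose[OF _ u])
    have "sq_integrable M (\<lambda>\<omega>. u i (x (k - delay k i) \<omega>))" if "i \<in> I" for i
      using x[of "k - delay k i"] by (intro sq_integrable_lipschitz[OF lip[OF that]]) simp
    then show "sq_integrable M (g k)"
      unfolding g_def by (rule sq_integrable_sum)
  qed
  have x: "x k \<in> borel_measurable (?S k) \<and> sq_integrable M (x k)" for k
  proof (induction k rule: less_induct)
    case (less k)
    show ?case
    proof (cases k)
      case 0
      have "x 0 \<in> borel_measurable (?S 0)"
        using init by (subst measurable_cong[of _ _ "\<lambda>_. z0"]) auto
      moreover have "sq_integrable M (x 0)"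
        using init by (subst sq_integrable_cong[of _ _ "\<lambda>_. z0"]) (auto simp: sq_integrable_def)
      ultimately show ?thesis using 0 by simp
    next
      case (Suc j)
      have gj: "g j \<in> borel_measurable (?S j)" "sq_integrable M (g j)"
        using g[of j] less Suc by auto
      have xj: "x j \<in> borel_measurable (?S j)" "sq_integrable M (x j)"
        using less Suc by auto
      have Q_meas: "(\<lambda>(v, s). Q v s) \<in> borel_measurable (borel \<Otimes>\<^sub>M N)"
        using Q by (simp add: URQ_def)
      have "(\<lambda>\<omega>. (g j \<omega>, \<xi> j \<omega>)) \<in> measurable (?S (Suc j)) (borel \<Otimes>\<^sub>M N)"
        using measurable_past_seeds_mono[OF \<xi> _ gj(1), of "Suc j"] measurable_past_seeds_seed[OF \<xi>]
        by (intro measurable_Pair) auto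
      from measurable_compose[OF this Q_meas]
      have "(\<lambda>\<omega>. x j \<omega> - \<gamma> *\<^sub>R Q (g j \<omega>) (\<xi> j \<omega>)) \<in> borel_measurable (?S (Suc j))"
        using measurable_past_seeds_mono[OF \<xi> _ xj(1), of "Suc j"] by simp
      then have "x (Suc j) \<in> borel_measurable (?S (Suc j))"
        using step by (subst measurable_cong[of _ _ "\<lambda>\<omega>. x j \<omega> - \<gamma> *\<^sub>R Q (g j \<omega>) (\<xi> j \<omega>)"]) auto
      moreover have "sq_integrable M (\<lambda>\<omega>. x j \<omega> - \<gamma> *\<^sub>R Q (g j \<omega>) (\<xi> j \<omega>))"
        using fresh_quantization(1)[OF _ \<xi> law past_seeds_indep[OF indep] Q err gj]
        by (intro sq_integrable_diff sq_integrable_scaleR xj(2)) simp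
      then have "sq_integrable M (x (Suc j))"
        using step by (subst sq_integrable_cong[of _ _ "\<lambda>\<omega>. x j \<omega> - \<gamma> *\<^sub>R Q (g j \<omega>) (\<xi> j \<omega>)"]) auto
      ultimately show ?thesis using Suc by simp
    qed
  qed
  show "x k \<in> borel_measurable (?S k)" "sq_integrable M (x k)"
    using x by auto
  show "g k \<in> borel_measurable (?S k)" "sq_integrable M (g k)"
    using g x by auto
qed

section \<open>Convergence rate\<close>

theorem theorem4p7:
  fixes m :: nat and L fstar \<alpha> \<beta> \<theta> \<gamma> :: real and \<tau> :: nat
    and f :: "nat \<Rightarrow> real ^ 'd \<Rightarrow> real" and F :: "real ^ 'd \<Rightarrow> real"
    and l :: "real \<Rightarrow> real \<Rightarrow> real" and a :: "nat \<Rightarrow> real ^ 'd" and b :: "nat \<Rightarrow> real"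
    and delay :: "nat \<Rightarrow> nat \<Rightarrow> nat"
    and N :: "'s measure" and Q :: "real ^ 'd \<Rightarrow> 's \<Rightarrow> real ^ 'd"
    and M :: "'w measure" and \<xi> :: "nat \<Rightarrow> 'w \<Rightarrow> 's"
    and x0 :: "real ^ 'd" and x :: "nat \<Rightarrow> 'w \<Rightarrow> real ^ 'd"
  assumes m: "1 \<le> m" and L: "0 < L"
    and F: "\<And>z. F z = (\<Sum>i = 1..m. f i z)"
    and smooth: "\<And>i. i \<in> {1..m} \<Longrightarrow> convex_smooth L (f i)"
    and loss: "\<And>i z. i \<in> {1..m} \<Longrightarrow> f i z = l (inner (a i) z) (b i)"
    and supp_grad: "\<And>i z. i \<in> {1..m} \<Longrightarrow> supp (grad (f i) z) = supp (a i)"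
    and fstar_attained: "fstar \<in> range F" and fstar_le: "\<And>z. fstar \<le> F z"
    and URQ: "URQ N Q \<alpha>"
    and \<beta>: "0 < \<beta>" "\<beta> \<le> \<alpha> - 1"
    and Q_error: "\<And>v. (LINT s|N. (norm (Q v s - v))\<^sup>2) \<le> \<beta> * (norm v)\<^sup>2"
    and delay: "\<And>k i. i \<in> {1..m} \<Longrightarrow> delay k i \<le> \<tau>"
    and \<theta>: "0 < \<theta>" and \<beta>_small: "\<beta> < 1 / (2 * (1 + 1 / \<theta>))"
    and \<gamma>: "0 < \<gamma>"
      "\<gamma> < 1 / (1 + sqrt (1 + 8 * (1 + \<beta> * (1 + \<theta>)) * real \<tau> * (real \<tau> + 1))) * (2 / Lbar L m a)"
    and M: "prob_space M"
    and seeds_indep: "prob_space.indep_vars M (\<lambda>_. N) \<xi> UNIV"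
    and seeds_law: "\<And>k. distr M N (\<xi> k) = N"
    and iterates: "\<And>\<omega>. \<omega> \<in> space M \<Longrightarrow>
      quantized_delayed_gradient_path m f delay \<gamma> Q (\<lambda>k. \<xi> k \<omega>) x0 (\<lambda>k. x k \<omega>)"
  shows "\<forall>K::nat.
    (\<forall>k\<in>{0..K}. integrable M (\<lambda>\<omega>. (norm (grad F (x k \<omega>)))\<^sup>2)) \<and>
    (MIN k\<in>{0..K}. LINT \<omega>|M. (norm (grad F (x k \<omega>)))\<^sup>2)
      \<le> 1 / (\<gamma> / 2 - \<gamma> * \<beta> * (1 + 1 / \<theta>)) * (1 / (real K + 1)) * (F x0 - fstar)"
proof -
  interpret prob_space M by (rule M)
  define \<Lambda> where "\<Lambda> = Lbar L m a"
  define g where "g k \<omega> = (\<Sum>i = 1..m. grad (f i) (x (k - delay k i) \<omega>))" for k \<omega>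
  define q where "q k \<omega> = Q (g k \<omega>) (\<xi> k \<omega>)" for k \<omega>
  have \<Lambda>: "0 < \<Lambda>"
    unfolding \<Lambda>_def by (rule Lbar_pos[OF m L])
  have F_eq: "F = (\<lambda>z. \<Sum>i = 1..m. f i z)"
    using F by (rule ext)
  have gradF: "grad F z = (\<Sum>i = 1..m. grad (f i) z)" for z
    unfolding F_eq by (rule sum_convex_smooth(1)[OF m L smooth supp_grad])
  have smoothF: "convex_smooth \<Lambda> F"
    unfolding F_eq \<Lambda>_def by (rule sum_convex_smooth(2)[OF m L smooth supp_grad])
  have lipF: "\<Lambda>-lipschitz_on UNIV (grad F)"
    using smoothF convex_smooth_iff_lipschitz[OF \<Lambda>] by blast
  have lipf: "L-lipschitz_on UNIV (grad (f i))" if "i \<in> {1..m}" for i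
    using smooth[OF that] convex_smooth_iff_lipschitz[OF L] by blast
  have init: "x 0 \<omega> = x0" if "\<omega> \<in> space M" for \<omega>
    using iterates[OF that] by (simp add: quantized_delayed_gradient_path_def)
  have step: "x (Suc k) \<omega> = x k \<omega> - \<gamma> *\<^sub>R q k \<omega>" if "\<omega> \<in> space M" for k \<omega>
    using iterates[OF that] by (simp add: quantized_delayed_gradient_path_def q_def g_def)
  have \<xi>: "\<xi> k \<in> measurable M N" for k
    using seeds_indep by (simp add: indep_vars_def)
  have adapted: "x k \<in> borel_measurable (past_seeds M N \<xi> k)" "sq_integrable M (x k)"
    "g k \<in> borel_measurable (past_seeds M N \<xi> k)" "sq_integrable M (g k)" for k
    by (rule delayed_iterates_adapted[where u = "\<lambda>i. grad (f i)" and g = g and x = x and k = k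
        and delay = delay and I = "{1..m}" and C = L and N = N and \<xi> = \<xi> and Q = Q
        and \<alpha> = \<alpha> and \<beta> = \<beta> and ?z0.0 = x0 and \<gamma> = \<gamma>,
        OF g_def lipf seeds_indep seeds_law URQ Q_error init step[unfolded q_def]]; assumption)+
  have gradF_sq: "sq_integrable M (\<lambda>\<omega>. grad F (x k \<omega>))" for k
    by (rule sq_integrable_lipschitz[OF lipF adapted(2)])
  have gradF_meas: "(\<lambda>\<omega>. grad F (x k \<omega>)) \<in> borel_measurable (past_seeds M N \<xi> k)" for k
    by (intro measurable_compose[OF adapted(1)] borel_measurable_continuous_onI
        lipschitz_on_continuous_on[OF lipF])
  define \<Phi> where "\<Phi> k = (LINT \<omega>|M. F (x k \<omega>))" for k
  define P where "P k = (LINT \<omega>|M. (norm (grad F (x k \<omega>)))\<^sup>2)" for k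
  define G where "G k = (LINT \<omega>|M. (norm (g k \<omega>))\<^sup>2)" for k
  define E where "E k = (LINT \<omega>|M. (norm (grad F (x k \<omega>) - g k \<omega>))\<^sup>2)" for k
  define D where "D k = (LINT \<omega>|M. (norm (q k \<omega>))\<^sup>2)" for k
  define h where "h = \<gamma> * \<Lambda>"
  define B where "B = \<beta> * (1 + 1 / \<theta>)"
  define c where "c = 1 + \<beta> * (1 + \<theta>)"
  have fresh: "sq_integrable M (q k)" "D k \<le> (1 + \<beta>) * G k"
    "(LINT \<omega>|M. inner (grad F (x k \<omega>)) (q k \<omega>)) = (LINT \<omega>|M. inner (grad F (x k \<omega>)) (g k \<omega>))" for k
  proof -
    note fresh_k = fresh_quantization[where S = "past_seeds M N \<xi> k" and N = N and \<eta> = "\<xi> k"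
        and Q = Q and \<alpha> = \<alpha> and \<beta> = \<beta> and V = "g k", OF space_past_seeds \<xi> seeds_law
        past_seeds_indep[OF seeds_indep] URQ Q_error adapted(3,4), folded q_def]
    show "sq_integrable M (q k)"
      using fresh_k(1) .
    show "D k \<le> (1 + \<beta>) * G k"
      unfolding D_def G_def by (rule fresh_k(2))
    show "(LINT \<omega>|M. inner (grad F (x k \<omega>)) (q k \<omega>)) = (LINT \<omega>|M. inner (grad F (x k \<omega>)) (g k \<omega>))"
      by (rule fresh_k(3)[OF gradF_meas gradF_sq])
  qed
  note err_sq = sq_integrable_diff[OF gradF_sq adapted(4)]
  note sq_int = gradF_sq[unfolded sq_integrable_def, THEN conjunct2]
    adapted(4)[unfolded sq_integrable_def, THEN conjunct2]
    fresh(1)[unfolded sq_integrable_def, THEN conjunct2]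
    err_sq[unfolded sq_integrable_def, THEN conjunct2]
  note F_int = integrable_convex_smooth[OF smoothF adapted(2)]
  have descent: "\<Phi> (Suc k) \<le> \<Phi> k - \<gamma> / 2 * (P k + G k - E k) + \<gamma> * h / 2 * D k" for k
  proof -
    note inner_int = sq_integrable_integrable_inner[OF gradF_sq fresh(1)]
    note inner_int' = sq_integrable_integrable_inner[OF gradF_sq adapted(4)]
    have "F (x (Suc k) \<omega>) \<le> F (x k \<omega>) - \<gamma> * inner (grad F (x k \<omega>)) (q k \<omega>)
        + \<gamma> * h / 2 * (norm (q k \<omega>))\<^sup>2" if \<omega>: "\<omega> \<in> space M" for \<omega>
    proof -
      have "F (x (Suc k) \<omega>) \<le> F (x k \<omega>) + inner (grad F (x k \<omega>)) (x (Suc k) \<omega> - x k \<omega>)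
          + \<Lambda> / 2 * (norm (x (Suc k) \<omega> - x k \<omega>))\<^sup>2"
        using smoothF by (simp add: convex_smooth_def)
      then show ?thesis
        by (simp add: step[OF \<omega>] h_def power_mult_distrib power2_eq_square mult_ac)
    qed
    then have "\<Phi> (Suc k) \<le> (LINT \<omega>|M. F (x k \<omega>) - \<gamma> * inner (grad F (x k \<omega>)) (q k \<omega>)
        + \<gamma> * h / 2 * (norm (q k \<omega>))\<^sup>2)"
      unfolding \<Phi>_def using F_int sq_int inner_int by (intro integral_mono) auto
    also have "\<dots> = \<Phi> k - \<gamma> * (LINT \<omega>|M. inner (grad F (x k \<omega>)) (q k \<omega>)) + \<gamma> * h / 2 * D k"
      unfolding \<Phi>_def D_def using F_int sq_int inner_int by simp
    also have "(LINT \<omega>|M. inner (grad F (x k \<omega>)) (q k \<omega>)) = (LINT \<omega>|M. inner (grad F (x k \<omega>)) (g k \<omega>))"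
      by (rule fresh(3))
    \<comment> \<open>the polarization identity \<open>2 \<langle>u, v\<rangle> = \<parallel>u\<parallel>\<^sup>2 + \<parallel>v\<parallel>\<^sup>2 - \<parallel>u - v\<parallel>\<^sup>2\<close> brings in the staleness error\<close>
    also have "\<dots> = (LINT \<omega>|M. ((norm (grad F (x k \<omega>)))\<^sup>2 + (norm (g k \<omega>))\<^sup>2
        - (norm (grad F (x k \<omega>) - g k \<omega>))\<^sup>2) / 2)"
      by (intro Bochner_Integration.integral_cong refl)
        (simp add: power2_norm_eq_inner inner_diff_left inner_diff_right inner_commute)
    also have "\<dots> = (P k + G k - E k) / 2"
      unfolding P_def G_def E_def using sq_int by simp
    finally show ?thesis by simp
  qed
  have second_moment: "D k \<le> G k + B * P k + (c - 1) * E k" for k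
  proof -
    have "G k \<le> (LINT \<omega>|M. (1 + 1 / \<theta>) * (norm (grad F (x k \<omega>)))\<^sup>2
        + (1 + \<theta>) * (norm (grad F (x k \<omega>) - g k \<omega>))\<^sup>2)"
      unfolding G_def using sq_int \<theta> by (intro integral_mono power2_norm_le_weighted) auto
    also have "\<dots> = (1 + 1 / \<theta>) * P k + (1 + \<theta>) * E k"
      unfolding P_def E_def using sq_int by simp
    finally have "\<beta> * G k \<le> \<beta> * ((1 + 1 / \<theta>) * P k + (1 + \<theta>) * E k)"
      using \<beta> by simp
    moreover have "D k \<le> (1 + \<beta>) * G k"
      by (rule fresh(2))
    ultimately show ?thesis
      unfolding B_def c_def by (simp add: algebra_simps)
  qed
  have staleness: "E k \<le> h\<^sup>2 * (real \<tau> * (\<Sum>j\<in>{k - \<tau>..<k}. D j))" for k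
  proof -
    have "(norm (grad F (x k \<omega>) - g k \<omega>))\<^sup>2 \<le> h\<^sup>2 * (real \<tau> * (\<Sum>j\<in>{k - \<tau>..<k}. (norm (q j \<omega>))\<^sup>2))"
      if \<omega>: "\<omega> \<in> space M" for \<omega>
    proof -
      let ?r = "\<Sum>j\<in>{k - \<tau>..<k}. norm (x (Suc j) \<omega> - x j \<omega>)"
      have "norm (grad F (x k \<omega>) - g k \<omega>) \<le> \<Lambda> * ?r"
        unfolding gradF g_def \<Lambda>_def
        by (rule sum_grad_diff_le[OF m L smooth supp_grad
              delayed_iterate_gap[where x = "\<lambda>k. x k \<omega>", OF delay]])
      also have "?r = \<gamma> * (\<Sum>j\<in>{k - \<tau>..<k}. norm (q j \<omega>))"
        using \<gamma>(1) by (simp add: step[OF \<omega>] sum_distrib_left)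
      finally have "(norm (grad F (x k \<omega>) - g k \<omega>))\<^sup>2 \<le> (h * (\<Sum>j\<in>{k - \<tau>..<k}. norm (q j \<omega>)))\<^sup>2"
        by (intro power_mono) (auto simp: h_def mult_ac)
      also have "\<dots> \<le> h\<^sup>2 * (real \<tau> * (\<Sum>j\<in>{k - \<tau>..<k}. (norm (q j \<omega>))\<^sup>2))"
        unfolding power_mult_distrib by (intro mult_left_mono power2_window_sum_le) auto
      finally show ?thesis .
    qed
    then have "E k \<le> (LINT \<omega>|M. h\<^sup>2 * (real \<tau> * (\<Sum>j\<in>{k - \<tau>..<k}. (norm (q j \<omega>))\<^sup>2)))"
      unfolding E_def using sq_int by (intro integral_mono) auto
    also have "\<dots> = h\<^sup>2 * (real \<tau> * (\<Sum>j\<in>{k - \<tau>..<k}. D j))"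
      unfolding D_def using sq_int by simp
    finally show ?thesis .
  qed
  have D: "0 \<le> D k" and P: "0 \<le> P k" for k
    by (simp_all add: D_def P_def)
  have c: "0 \<le> c"
    using \<beta> \<theta> by (simp add: c_def)
  have h: "h + c * h\<^sup>2 * (real \<tau>)\<^sup>2 \<le> 1"
  proof -
    \<comment> \<open>chosen so that the radicand in the step size bound is \<open>1 + 4 A\<close>; \<open>A\<close> is at least the coefficient \<open>c \<tau>\<^sup>2\<close> that is needed\<close>
    define A where "A = 2 * c * real \<tau> * (real \<tau> + 1)"
    have "1 + 8 * (1 + \<beta> * (1 + \<theta>)) * real \<tau> * (real \<tau> + 1) = 1 + 4 * A"
      by (simp add: A_def c_def algebra_simps)
    then have "\<gamma> < 1 / (1 + sqrt (1 + 4 * A)) * (2 / \<Lambda>)"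
      using \<gamma>(2) by (simp add: \<Lambda>_def)
    then have "\<gamma> * \<Lambda> < 1 / (1 + sqrt (1 + 4 * A)) * (2 / \<Lambda>) * \<Lambda>"
      using \<Lambda> by (rule mult_strict_right_mono)
    then have "h < 2 / (1 + sqrt (1 + 4 * A))"
      using \<Lambda> by (simp add: h_def)
    moreover have "0 \<le> A"
      using c by (simp add: A_def)
    moreover have "0 < h"
      using \<gamma>(1) \<Lambda> by (simp add: h_def)
    ultimately have "h + A * h\<^sup>2 \<le> 1"
      by (intro step_size_margin)
    moreover have "c * (real \<tau>)\<^sup>2 * h\<^sup>2 \<le> A * h\<^sup>2"
    proof (rule mult_right_mono)
      have "(real \<tau>)\<^sup>2 \<le> 2 * (real \<tau> * (real \<tau> + 1))"
        by (simp add: power2_eq_square algebra_simps)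
      from mult_left_mono[OF this c] show "c * (real \<tau>)\<^sup>2 \<le> A"
        by (simp add: A_def mult_ac)
    qed simp
    ultimately show ?thesis by (simp add: mult_ac)
  qed
  have B: "0 \<le> B" "B < 1 / 2"
  proof -
    have "0 < 1 + 1 / \<theta>" using \<theta> by (simp add: add_pos_pos)
    then show "0 \<le> B" "B < 1 / 2"
      unfolding B_def using \<beta>_small \<beta>(1)
      by (simp, simp add: pos_less_divide_eq algebra_simps)
  qed
  define a' where "a' = \<gamma> / 2 - \<gamma> * \<beta> * (1 + 1 / \<theta>)"
  \<comment> \<open>twice the loss \<open>B\<close> that the descent argument incurs, hence a weaker constant than the one obtained below\<close>
  have a'_eq: "a' = \<gamma> / 2 * (1 - 2 * B)"
    by (simp add: a'_def B_def field_simps)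
  have a': "0 < a'" "a' \<le> \<gamma> / 2 * (1 - B)"
    unfolding a'_eq using B \<gamma>(1) by (auto intro!: mult_pos_pos mult_left_mono)
  show ?thesis
  proof (intro allI conjI ballI)
    fix K
    show "integrable M (\<lambda>\<omega>. (norm (grad F (x k \<omega>)))\<^sup>2)" for k
      by (rule sq_int)
    let ?min = "MIN k\<in>{0..K}. P k"
    have "fstar = (LINT \<omega>|M. fstar)"
      by (simp add: prob_space)
    also have "\<dots> \<le> \<Phi> (Suc K)"
      unfolding \<Phi>_def using F_int fstar_le by (intro integral_mono) auto
    finally have \<Phi>_end: "fstar \<le> \<Phi> (Suc K)" .
    have "\<Phi> 0 = (LINT \<omega>|M. F x0)"
      unfolding \<Phi>_def using init by (intro Bochner_Integration.integral_cong) auto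
    then have \<Phi>_start: "\<Phi> 0 = F x0"
      by (simp add: prob_space)
    have "(real K + 1) * ?min = (\<Sum>k\<le>K. ?min)"
      by simp
    also have "\<dots> \<le> (\<Sum>k\<le>K. P k)"
      by (intro sum_mono Min_le) auto
    finally have "a' * ((real K + 1) * ?min) \<le> a' * (\<Sum>k\<le>K. P k)"
      using a' by simp
    also have "\<dots> \<le> \<gamma> / 2 * (1 - B) * (\<Sum>k\<le>K. P k)"
      using a' P by (intro mult_right_mono sum_nonneg) auto
    also have "\<dots> \<le> \<Phi> 0 - \<Phi> (Suc K)"
      by (rule delayed_descent_sum[OF descent second_moment staleness D \<gamma>(1) c h])
    also have "\<dots> \<le> F x0 - fstar"
      using \<Phi>_end \<Phi>_start by simp
    finally have "?min \<le> 1 / a' * (1 / (real K + 1)) * (F x0 - fstar)"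
      using a'(1) by (simp add: pos_le_divide_eq mult_ac)
    then show "(MIN k\<in>{0..K}. LINT \<omega>|M. (norm (grad F (x k \<omega>)))\<^sup>2)
      \<le> 1 / (\<gamma> / 2 - \<gamma> * \<beta> * (1 + 1 / \<theta>)) * (1 / (real K + 1)) * (F x0 - fstar)"
      unfolding P_def a'_def .
  qed
qed

end
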